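(* Consider the setting described in the context, in the learnable-only regime $p_{\mathrm{un}}=0$ (equivalently $\mathcal S_U=\emptyset$): assume all parameter conditions (i)–(ix) hold except that condition (vii) is replaced by $p_{\mathrm{un}}=0$. Run adversarial training (objective $\mathcal L_{\mathrm{AT}}$) by gradient descent for $T$ iterations. Then, on the event $\mathcal E$: (1) there exists a filter $r\in[m]$ with $w^{(T)}_{r,1}\ge\tilde\Omega(\alpha^{-1})$; (2) for every filter $r\in[m]$, every $i\in[N]$ and every noise patch $j\neq s(\mathbf X_i)$, $\left|\langle \mathbf w_r^{(T)},\mathbf x_{i,j}\rangle\right|\le\tilde O(\sigma_0\sigma_n\sqrt d)$. Consequently, both the robust training error and the robust test error $\mathcal L^{\mathrm{rob}}_{\mathcal D_L}(f_{\mathbf W^{(T)}})$ are $o(1)$.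
   Context: Data. Fix integers $N,P,d,m$ and reals $\alpha,\sigma_n,\sigma_0,\eta,\epsilon,\Gamma>0$, $\delta\in(0,1)$, and a horizon $T\in\mathbb N$. Let $\mathbf u=\mathbf e_1$, $\mathbf v=\mathbf e_d$ in $\mathbb R^d$ and $\Pi_{\mathcal F}$ the orthogonal projection onto $\mathcal F=\mathrm{span}\{\mathbf u,\mathbf v\}$. Fix a partition $[N]=\mathcal S_L\sqcup\mathcal S_U$ and let $p_{\mathrm{un}}=|\mathcal S_U|/N$. Independently for each $i\in[N]$: $y_i$ is uniform on $\{+1,-1\}$, the signal patch index $s(\mathbf X_i)$ is uniform on $[P]$, $\mathbf X_i=(\mathbf x_{i,1},\dots,\mathbf x_{i,P})\in\mathbb R^{P\times d}$ with $\mathbf x_{i,s(\mathbf X_i)}=\alpha y_i\mathbf u$ if $i\in\mathcal S_L$ and $=\alpha y_i\mathbf v$ if $i\in\mathcal S_U$, and for $p\ne s(\mathbf X_i)$ the noise patches $\mathbf x_{i,p}\sim\mathcal N(\mathbf 0,\sigma_n^2(\mathbf I_d-\Pi_{\mathcal F}))$ are independent. The test distribution $\mathcal D_L$ draws $(\mathbf X,y)$ by the same rule with learnable signal patch $\alpha y\mathbf u$ and independent Gaussian noise patches. Student. $f_{\mathbf W}(\mathbf X)=\sum_{r=1}^m\sum_{p=1}^P[\phi(\langle\mathbf w_r,\mathbf x_p\rangle)-\phi(-\langle\mathbf w_r,\mathbf x_p\rangle)]$ with $\phi(z)=(\max\{0,z\})^3$. Initialization: $w^{(0)}_{r,j}\sim\mathcal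 N(0,\sigma_0^2)$ i.i.d. for $j\le d-1$ and $w^{(0)}_{r,d}=0$; the constraint $\langle\mathbf w_r,\mathbf v\rangle=0$ is kept throughout training. $w_{r,1}=\langle\mathbf w_r,\mathbf e_1\rangle$. Training. $\ell(z)=\log(1+e^{-z})$, $\sigma(z)=(1+e^{-z})^{-1}$, $\psi(z)=\sigma(-z)$. At iteration $t$, $\tilde{\mathbf X}_i^{(t)}$ maximizes $\ell(y_if_{\mathbf W^{(t)}}(\mathbf X'))$ over $\mathbf X'$ with $\|\mathbf X'-\mathbf X_i\|_\infty\le\epsilon$ and $\mathbf X'-\mathbf X_i\in\mathrm{span}(\mathbf x_{i,s(\mathbf X_i)})$ (only the signal patch is perturbed, along its own direction). AT objective: $\mathcal L_{\mathrm{AT}}(\mathbf W;\mathbf X,y)=\ell(yf_{\mathbf W}(\tilde{\mathbf X}))$. Gradient descent: $\mathbf W^{(t+1)}=\mathbf W^{(t)}-\frac{\eta}{N}\sum_{i}\nabla_{\mathbf W}\mathcal L(\mathbf W^{(t)};\mathbf X_i,y_i)$ with $\tilde{\mathbf X}_i^{(t)}$ held fixed. Errors. Robust test error $\mathcal L^{\mathrm{rob}}_{\mathcal D_L}(f)=\Pr_{(\mathbf X,y)\sim\mathcal D_L}[\min_{\|\boldsymbol\delta\|_\infty\le\epsilon}yf(\mathbf X+\boldsymbol\delta)<0]$. Robust training error is measured by the average adversarial logistic loss $\frac1N\sum_i\ell(y_if_{\mathbf W^{(T)}}(\tilde{\mathbf X}^{(T)}_i))$. $\tilde O,\tilde\Omega$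 hide polylogarithmic factors; $o(1)$ denotes a quantity vanishing in the asymptotic regime of the conditions. Parameter conditions (for a sufficiently large universal constant $C>0$): (i) $T\ge CN/(\eta\sigma_0\sigma_n^3d^{3/2})$; (ii) $d\ge Cm^2P^2N^2\log^4(TNmP/\delta)$; (iii) $\alpha\ge C\sigma_n\sqrt d\log(TNmP/\delta)/(N^{1/3}(1-p_{\mathrm{un}})^{1/3})$; (iv) $\sigma_0\le C^{-1}\min\{\frac{1}{m^{2/3}P^{2/3}\sigma_n\sqrt d},\frac{1}{\alpha m^{2/3}},\frac{1}{\sigma_nm^2P^{1/2}d}\}/\log(TdNmP/\delta)$; (v) $\eta\le C^{-1}\min\{\frac1{\alpha^3\sigma_0},\frac1{\sigma_n^2d},\frac1{\alpha^2}\}/\log(TNmP/\delta)$; (vi) $C\sigma_nmP^{1/2}\log(TdNP/\delta)\le\epsilon<C^{-1}\min\{\alpha,\frac1{m\sigma_0d}\}$; (vii) $C/N\le p_{\mathrm{un}}\le C^{-1}\log d/N$ and $N\ge CmP\log(TdNmP/\delta)$; (viii) $C\log(NP/\delta)\le m\le C\log^Cd$, $2\le P\le C$; (ix) $\Gamma\ge Cd$. Event $\mathcal E$: for all $r\in[m]$, $i,k\in[N]$, $j\ne s(\mathbf X_i)$, $q\ne s(\mathbf X_k)$, $(i,j)\ne(k,q)$: $\frac12\sigma_n^2d\le\|\mathbf x_{i,j}\|_2^2\le\frac32\sigma_n^2d$; $|\langle\mathbf x_{i,j},\mathbf x_{k,q}\rangle|\le2\sigma_n^2\sqrt{d\log(16N^2P^2/\delta)}$;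 $\|\mathbf x_{i,j}\|_\infty\le\sigma_n\sqrt{2\log(16dNP/\delta)}$; $\|\mathbf w_r^{(0)}\|_2\le2\sigma_0\sqrt d$; $|\langle\mathbf w^{(0)}_r,\mathbf e_1\rangle|\le\sigma_0\sqrt{2\log(16m/\delta)}$; $|\langle\mathbf w^{(0)}_r,\mathbf x_{i,j}\rangle|\le2\sigma_0\sigma_n\sqrt{d\log(16NmP/\delta)}$; $\frac12\sigma_0\le\max_r\langle\mathbf w^{(0)}_r,\mathbf e_1\rangle\le\sigma_0\sqrt{2\log(16m/\delta)}$; $\frac14\sigma_0\sigma_n\sqrt d\le\max_ry_i\langle\mathbf w^{(0)}_r,\mathbf x_{i,j}\rangle\le2\sigma_0\sigma_n\sqrt{d\log(16NmP/\delta)}$. *)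

theory Defs
  imports "HOL-Probability.Probability"
begin

text \<open>Vectors in R^d are functions nat => real; only coordinates 0..d-1 matter.
  Coordinate index 0 is e_1 = u, coordinate index d-1 is e_d = v.
  A data point X is nat => nat => real: X p j = j-th coordinate of patch p (p < P).
  Weights W is nat => nat => real: W r j = j-th coordinate of filter r (r < m).\<close>

definition ip :: "nat \<Rightarrow> (nat \<Rightarrow> real) \<Rightarrow> (nat \<Rightarrow> real) \<Rightarrow> real" where
  "ip d a b = (\<Sum>j<d. a j * b j)"

definition phi :: "real \<Rightarrow> real" where
  "phi z = (max 0 z) ^ 3"

definition phi' :: "real \<Rightarrow> real" where
  "phi' z = 3 * (max 0 z) ^ 2"

definition fW :: "nat \<Rightarrow> nat \<Rightarrow> nat \<Rightarrow> (nat \<Rightarrow> nat \<Rightarrow> real) \<Rightarrow> (nat \<Rightarrow> nat \<Rightarrow> real) \<Rightarrow> real" where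
  "fW m P d W X = (\<Sum>r<m. \<Sum>p<P. phi (ip d (W r) (X p)) - phi (- ip d (W r) (X p)))"

definition logloss :: "real \<Rightarrow> real" where
  "logloss z = ln (1 + exp (- z))"

definition sigm :: "real \<Rightarrow> real" where
  "sigm z = 1 / (1 + exp (- z))"

definition psi :: "real \<Rightarrow> real" where
  "psi z = sigm (- z)"

definition perturb :: "(nat \<Rightarrow> nat \<Rightarrow> real) \<Rightarrow> nat \<Rightarrow> real \<Rightarrow> nat \<Rightarrow> nat \<Rightarrow> real" where
  "perturb X s c = (\<lambda>p j. if p = s \<and> j = 0 then X p j + c else X p j)"

text \<open>Adversarial example at iteration t: c is a maximiser over |c| <= eps (the l_inf ball
  intersected with span of the signal patch alpha*y*u, alpha > 0).\<close>
definition is_adv :: "nat \<Rightarrow> nat \<Rightarrow> nat \<Rightarrow> real \<Rightarrow> (nat \<Rightarrow> nat \<Rightarrow> real)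
    \<Rightarrow> (nat \<Rightarrow> nat \<Rightarrow> real) \<Rightarrow> real \<Rightarrow> nat \<Rightarrow> real \<Rightarrow> bool" where
  "is_adv m P d eps W X y s c \<longleftrightarrow> \<bar>c\<bar> \<le> eps \<and>
     (\<forall>c'. \<bar>c'\<bar> \<le> eps \<longrightarrow>
        logloss (y * fW m P d W (perturb X s c')) \<le> logloss (y * fW m P d W (perturb X s c)))"

text \<open>Gradient of logloss(y f_W(Xt)) with respect to coordinate j of filter r.\<close>
definition grad_AT :: "nat \<Rightarrow> nat \<Rightarrow> nat \<Rightarrow> (nat \<Rightarrow> nat \<Rightarrow> real) \<Rightarrow> (nat \<Rightarrow> nat \<Rightarrow> real)
    \<Rightarrow> real \<Rightarrow> nat \<Rightarrow> nat \<Rightarrow> real" where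
  "grad_AT m P d W Xt y r j =
     - psi (y * fW m P d W Xt) * y *
       (\<Sum>p<P. (phi' (ip d (W r) (Xt p)) + phi' (- ip d (W r) (Xt p))) * Xt p j)"

text \<open>Training data in the learnable-only regime (S_U empty): labels, signal position,
  signal patch alpha*y*u, noise patches in the support of N(0, sigma_n^2 (I - Pi_F)).\<close>
definition data_ok :: "nat \<Rightarrow> nat \<Rightarrow> nat \<Rightarrow> real \<Rightarrow> (nat \<Rightarrow> real) \<Rightarrow> (nat \<Rightarrow> nat)
    \<Rightarrow> (nat \<Rightarrow> nat \<Rightarrow> nat \<Rightarrow> real) \<Rightarrow> bool" where
  "data_ok N P d \<alpha> y s X \<longleftrightarrow> (\<forall>i<N.
     (y i = 1 \<or> y i = -1) \<and> s i < P \<and>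
     (\<forall>j<d. X i (s i) j = (if j = 0 then \<alpha> * y i else 0)) \<and>
     (\<forall>p<P. p \<noteq> s i \<longrightarrow> X i p 0 = 0 \<and> X i p (d - 1) = 0))"

definition event_E :: "nat \<Rightarrow> nat \<Rightarrow> nat \<Rightarrow> nat \<Rightarrow> real \<Rightarrow> real \<Rightarrow> real \<Rightarrow> (nat \<Rightarrow> real)
    \<Rightarrow> (nat \<Rightarrow> nat) \<Rightarrow> (nat \<Rightarrow> nat \<Rightarrow> nat \<Rightarrow> real) \<Rightarrow> (nat \<Rightarrow> nat \<Rightarrow> real) \<Rightarrow> bool" where
  "event_E N P d m \<sigma>n \<sigma>0 \<delta> y s X W0 \<longleftrightarrow>
    (\<forall>i<N. \<forall>j<P. j \<noteq> s i \<longrightarrow>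
        \<sigma>n\<^sup>2 * d / 2 \<le> ip d (X i j) (X i j) \<and> ip d (X i j) (X i j) \<le> 3 * \<sigma>n\<^sup>2 * d / 2) \<and>
    (\<forall>i<N. \<forall>j<P. \<forall>k<N. \<forall>q<P. j \<noteq> s i \<longrightarrow> q \<noteq> s k \<longrightarrow> (i, j) \<noteq> (k, q) \<longrightarrow>
        \<bar>ip d (X i j) (X k q)\<bar> \<le> 2 * \<sigma>n\<^sup>2 * sqrt (d * ln (16 * N\<^sup>2 * P\<^sup>2 / \<delta>))) \<and>
    (\<forall>i<N. \<forall>j<P. j \<noteq> s i \<longrightarrow>
        (\<forall>l<d. \<bar>X i j l\<bar> \<le> \<sigma>n * sqrt (2 * ln (16 * d * N * P / \<delta>)))) \<and>
    (\<forall>r<m. sqrt (ip d (W0 r) (W0 r)) \<le> 2 * \<sigma>0 * sqrt d) \<and>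
    (\<forall>r<m. \<bar>W0 r 0\<bar> \<le> \<sigma>0 * sqrt (2 * ln (16 * m / \<delta>))) \<and>
    (\<forall>r<m. \<forall>i<N. \<forall>j<P. j \<noteq> s i \<longrightarrow>
        \<bar>ip d (W0 r) (X i j)\<bar> \<le> 2 * \<sigma>0 * \<sigma>n * sqrt (d * ln (16 * N * m * P / \<delta>))) \<and>
    \<sigma>0 / 2 \<le> Max ((\<lambda>r. W0 r 0) ` {..<m}) \<and>
    Max ((\<lambda>r. W0 r 0) ` {..<m}) \<le> \<sigma>0 * sqrt (2 * ln (16 * m / \<delta>)) \<and>
    (\<forall>i<N. \<forall>j<P. j \<noteq> s i \<longrightarrow>
        \<sigma>0 * \<sigma>n * sqrt d / 4 \<le> Max ((\<lambda>r. y i * ip d (W0 r) (X i j)) ` {..<m}) \<and>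
        Max ((\<lambda>r. y i * ip d (W0 r) (X i j)) ` {..<m})
          \<le> 2 * \<sigma>0 * \<sigma>n * sqrt (d * ln (16 * N * m * P / \<delta>)))"

text \<open>Parameter conditions (i)-(ix) with constant C, where (vii) is replaced by p_un = 0
  (so (iii) is written with (1 - p_un)^(1/3) = 1).\<close>
definition params_ok :: "real \<Rightarrow> nat \<Rightarrow> nat \<Rightarrow> nat \<Rightarrow> nat \<Rightarrow> real \<Rightarrow> real \<Rightarrow> real \<Rightarrow> real
    \<Rightarrow> real \<Rightarrow> real \<Rightarrow> real \<Rightarrow> nat \<Rightarrow> bool" where
  "params_ok C N P d m \<alpha> \<sigma>n \<sigma>0 \<eta> \<epsilon> \<Gamma> \<delta> T \<longleftrightarrow>
    N > 0 \<and> d > 0 \<and> m > 0 \<and> P > 0 \<and>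
    \<alpha> > 0 \<and> \<sigma>n > 0 \<and> \<sigma>0 > 0 \<and> \<eta> > 0 \<and> \<epsilon> > 0 \<and> \<Gamma> > 0 \<and> 0 < \<delta> \<and> \<delta> < 1 \<and>
    \<comment> \<open>(i)\<close>
    real T \<ge> C * N / (\<eta> * \<sigma>0 * \<sigma>n ^ 3 * d powr (3/2)) \<and>
    \<comment> \<open>(ii)\<close>
    real d \<ge> C * m\<^sup>2 * P\<^sup>2 * N\<^sup>2 * (ln (T * N * m * P / \<delta>)) ^ 4 \<and>
    \<comment> \<open>(iii) with p_un = 0\<close>
    \<alpha> \<ge> C * \<sigma>n * sqrt d * ln (T * N * m * P / \<delta>) / (real N powr (1/3)) \<and>
    \<comment> \<open>(iv)\<close>
    \<sigma>0 \<le> (1 / C) * Min {1 / (m powr (2/3) * P powr (2/3) * \<sigma>n * sqrt d),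
                         1 / (\<alpha> * m powr (2/3)),
                         1 / (\<sigma>n * m\<^sup>2 * sqrt P * d)} / ln (T * d * N * m * P / \<delta>) \<and>
    \<comment> \<open>(v)\<close>
    \<eta> \<le> (1 / C) * Min {1 / (\<alpha> ^ 3 * \<sigma>0), 1 / (\<sigma>n\<^sup>2 * d), 1 / \<alpha>\<^sup>2} / ln (T * N * m * P / \<delta>) \<and>
    \<comment> \<open>(vi)\<close>
    C * \<sigma>n * m * sqrt P * ln (T * d * N * P / \<delta>) \<le> \<epsilon> \<and>
    \<epsilon> < (1 / C) * min \<alpha> (1 / (m * \<sigma>0 * d)) \<and>
    \<comment> \<open>(viii)\<close>
    C * ln (N * P / \<delta>) \<le> m \<and> real m \<le> C * (ln d) powr C \<and> 2 \<le> P \<and> real P \<le> C \<and>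
    \<comment> \<open>(ix)\<close>
    \<Gamma> \<ge> C * d"

text \<open>Adversarial training by (projected, keeping <w_r, v> = 0) gradient descent:
  adv t i is the chosen maximiser for sample i at iteration t.\<close>
definition AT_traj :: "nat \<Rightarrow> nat \<Rightarrow> nat \<Rightarrow> nat \<Rightarrow> real \<Rightarrow> real \<Rightarrow> nat \<Rightarrow> (nat \<Rightarrow> real)
    \<Rightarrow> (nat \<Rightarrow> nat) \<Rightarrow> (nat \<Rightarrow> nat \<Rightarrow> nat \<Rightarrow> real) \<Rightarrow> (nat \<Rightarrow> nat \<Rightarrow> nat \<Rightarrow> real)
    \<Rightarrow> (nat \<Rightarrow> nat \<Rightarrow> real) \<Rightarrow> bool" where
  "AT_traj N P d m \<eta> \<epsilon> T y s X W adv \<longleftrightarrow>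
    (\<forall>r<m. W 0 r (d - 1) = 0) \<and>
    (\<forall>t\<le>T. \<forall>i<N. is_adv m P d \<epsilon> (W t) (X i) (y i) (s i) (adv t i)) \<and>
    (\<forall>t<T. \<forall>r<m. \<forall>j.
       W (Suc t) r j =
         (if j = d - 1 then W t r j
          else W t r j - \<eta> / N *
            (\<Sum>i<N. grad_AT m P d (W t) (perturb (X i) (s i) (adv t i)) (y i) r j)))"

definition rob_train_err :: "nat \<Rightarrow> nat \<Rightarrow> nat \<Rightarrow> nat \<Rightarrow> nat \<Rightarrow> (nat \<Rightarrow> real) \<Rightarrow> (nat \<Rightarrow> nat)
    \<Rightarrow> (nat \<Rightarrow> nat \<Rightarrow> nat \<Rightarrow> real) \<Rightarrow> (nat \<Rightarrow> nat \<Rightarrow> nat \<Rightarrow> real) \<Rightarrow> (nat \<Rightarrow> nat \<Rightarrow> real) \<Rightarrow> real" where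
  "rob_train_err N P d m T y s X W adv =
     (\<Sum>i<N. logloss (y i * fW m P d (W T) (perturb (X i) (s i) (adv T i)))) / N"

text \<open>Test distribution D_L: y uniform on {1,-1}, s uniform on {0..<P}, noise patches with
  i.i.d. N(0, sigma_n^2) coordinates on indices 1..d-2 (the orthogonal complement of F)
  and zero on coordinates 0 and d-1.\<close>
definition noise_meas :: "nat \<Rightarrow> nat \<Rightarrow> real \<Rightarrow> (nat \<times> nat \<Rightarrow> real) measure" where
  "noise_meas P d \<sigma>n = PiM ({..<P} \<times> {1..<d - 1}) (\<lambda>_. density lborel (normal_density 0 \<sigma>n))"

definition test_pt :: "nat \<Rightarrow> real \<Rightarrow> real \<Rightarrow> nat \<Rightarrow> (nat \<times> nat \<Rightarrow> real) \<Rightarrow> nat \<Rightarrow> nat \<Rightarrow> real" where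
  "test_pt d \<alpha> y s Z = (\<lambda>p j. if p = s then (if j = 0 then \<alpha> * y else 0)
                          else if 1 \<le> j \<and> j < d - 1 then Z (p, j) else 0)"

definition robust_bad :: "nat \<Rightarrow> nat \<Rightarrow> nat \<Rightarrow> (nat \<Rightarrow> nat \<Rightarrow> real) \<Rightarrow> real
    \<Rightarrow> (nat \<Rightarrow> nat \<Rightarrow> real) \<Rightarrow> real \<Rightarrow> bool" where
  "robust_bad m P d W \<epsilon> X y \<longleftrightarrow>
     (\<exists>\<Delta>. (\<forall>p<P. \<forall>j<d. \<bar>\<Delta> p j\<bar> \<le> \<epsilon>) \<and> y * fW m P d W (\<lambda>p j. X p j + \<Delta> p j) < 0)"

definition rob_test_err :: "nat \<Rightarrow> nat \<Rightarrow> nat \<Rightarrow> real \<Rightarrow> real \<Rightarrow> real \<Rightarrow> (nat \<Rightarrow> nat \<Rightarrow> real) \<Rightarrow> real" where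
  "rob_test_err m P d \<alpha> \<sigma>n \<epsilon> W =
     (\<Sum>y\<in>{1::real, -1}. \<Sum>s<P.
        measure (noise_meas P d \<sigma>n)
          {Z \<in> space (noise_meas P d \<sigma>n). robust_bad m P d W \<epsilon> (test_pt d \<alpha> y s Z) y})
     / (2 * P)"

definition AT_setting where
  "AT_setting C N P d m \<alpha> \<sigma>n \<sigma>0 \<eta> \<epsilon> \<Gamma> \<delta> T y s X W adv \<longleftrightarrow>
     params_ok C N P d m \<alpha> \<sigma>n \<sigma>0 \<eta> \<epsilon> \<Gamma> \<delta> T \<and>
     data_ok N P d \<alpha> y s X \<and>
     event_E N P d m \<sigma>n \<sigma>0 \<delta> y s X (W 0) \<and>
     AT_traj N P d m \<eta> \<epsilon> T y s X W adv"

end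

theory Submission
  imports Defs
begin

text \<open>
  The student is cubic, \<open>\<phi>(z) - \<phi>(-z) = z^3\<close>, and its signal part and noise part decouple:
  the signal coordinates obey \<open>w \<leftarrow> w + 3 \<beta> w^2\<close> with one common step size \<open>\<beta>(t) \<ge> 0\<close>.  For the
  filter with the largest initial signal coordinate, \<open>1/w\<close> telescopes and bounds \<open>\<Sum> \<beta>(t)\<close> by a
  multiple of \<open>1/\<sigma>0\<close> for the whole horizon; the growth factor per step stays below 2 because
  \<open>x \<psi>(x^3)\<close> is bounded.  The adversary minimises one and the same signal margin for all samples,
  so all \<open>\<psi>\<close>-factors are comparable and \<open>\<Sum> \<eta> \<psi>\<close> is of order \<open>1/(\<sigma>0 \<alpha>^3)\<close> for each of them.
  This is too little for the noise components to double, which closes the bootstrap.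
  Conversely \<open>T\<close> is so large that the bound on \<open>\<Sum> \<beta>(t)\<close> forces \<open>\<psi>\<close> to become small, that is, the
  total signal margin \<open>\<alpha>^3 \<Sum> w^3\<close> exceeds \<open>ln (ln (ln d))\<close>.  It dominates the effect of any
  perturbation, since \<open>\<epsilon>\<close> is small against \<open>\<alpha>\<close> and against the inverse \<open>l_1\<close>-norm of the remaining
  weights; second moments of the fresh noise suffice for the test error.
\<close>

subsection \<open>Scalar inequalities\<close>

lemma phi_diff: "phi z - phi (- z) = z ^ 3"
  by (cases "z \<ge> 0") (auto simp: phi_def max_def power3_eq_cube)

lemma phi'_sum: "phi' z + phi' (- z) = 3 * z\<^sup>2"
  by (cases "z \<ge> 0") (auto simp: phi'_def max_def)

lemma fW_eq_cubes: "fW m P d W X = (\<Sum>r<m. \<Sum>p<P. (ip d (W r) (X p)) ^ 3)"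
  by (simp add: fW_def phi_diff)

lemma psi_eq: "psi z = 1 / (1 + exp z)"
  by (simp add: psi_def sigm_def)

lemma psi_nonneg: "psi z \<ge> 0"
  by (simp add: psi_eq add_nonneg_nonneg)

lemma logloss_le_iff: "logloss a \<le> logloss b \<longleftrightarrow> b \<le> a"
  by (simp add: logloss_def add_pos_pos)

lemma logloss_le_exp: "logloss z \<le> exp (- z)"
  unfolding logloss_def by (rule ln_add_one_self_le_self) simp

text \<open>The denominators satisfy 1 + e^v \<le> e^b (1 + e^u). This compares the \<psi>-factors
  of samples whose margins differ by a bounded amount.\<close>

lemma psi_le_exp_mult:
  assumes "v \<le> u + b" "b \<ge> 0"
  shows "psi u \<le> exp b * psi v"
proof -
  have "exp v \<le> exp b * exp u" using assms by (simp flip: exp_add)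
  moreover have "1 \<le> exp b" using assms by simp
  ultimately have "1 + exp v \<le> exp b * (1 + exp u)" by (simp add: distrib_left del: one_le_exp_iff)
  then show ?thesis
    by (simp add: psi_eq field_simps add_pos_pos)
qed

lemma ln_16_le: "ln (16::real) \<le> 3"
proof -
  have "ln (16::real) = 4 * ln 2" using ln_realpow[of 2 4] by simp
  also have "\<dots> \<le> 3" using ln2_le_25_over_36 by simp
  finally show ?thesis .
qed

lemma L2_set_sum_le:
  "L2_set (\<lambda>j. \<Sum>i\<in>I. f i * x i j) A \<le> (\<Sum>i\<in>I. \<bar>f i\<bar> * L2_set (x i) A)"
proof (induction I rule: infinite_finite_induct)
  case (insert i I)
  have "L2_set (\<lambda>j. f i * x i j) A = \<bar>f i\<bar> * L2_set (x i) A"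
    by (simp add: L2_set_def power_mult_distrib real_sqrt_mult flip: sum_distrib_left)
  with insert L2_set_triangle_ineq[of "\<lambda>j. f i * x i j" "\<lambda>j. \<Sum>i\<in>I. f i * x i j" A]
  show ?case by simp
qed (simp_all add: L2_set_def)

lemma sum_abs_le_L2:
  fixes f :: "nat \<Rightarrow> real"
  shows "(\<Sum>j\<in>{1..<d}. \<bar>f j\<bar>) \<le> sqrt d * L2_set f {1..<d}"
proof -
  have "(\<Sum>j\<in>{1..<d}. \<bar>f j\<bar> * \<bar>1\<bar>) \<le> L2_set f {1..<d} * L2_set (\<lambda>_. 1) {1..<d}"
    by (rule L2_set_mult_ineq)
  also have "\<dots> \<le> L2_set f {1..<d} * sqrt d"
    by (intro mult_left_mono L2_set_nonneg) (simp add: L2_set_def)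
  finally show ?thesis by (simp add: mult.commute)
qed

lemma cube_ge_neg_part: "(x::real) ^ 3 \<ge> - (max 0 (- x) ^ 3)"
  by (cases "x \<ge> 0") (auto simp: max_def)

lemma power3_mono: "a \<le> b \<Longrightarrow> a ^ 3 \<le> b ^ 3" for a b :: real
  by (intro power_mono_odd) auto

text \<open>The gap between the two sides is 3 (a + b) (a - b)^2.\<close>

lemma cube_add_le: "(a + b) ^ 3 \<le> 4 * (a ^ 3 + b ^ 3)" if "a \<ge> 0" "b \<ge> 0" for a b :: real
proof -
  have "0 \<le> 3 * (a + b) * (a - b)\<^sup>2" using that by simp
  then show ?thesis by (simp add: power2_eq_square power3_eq_cube algebra_simps)
qed

text \<open>For b \<le> a this is \<open>cube_add_le\<close> applied to a - b and b; for b > a the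
  surplus is 3/4 a^3 + 3 a b (b - a).\<close>

lemma cube_diff_ge: "a ^ 3 / 4 - b ^ 3 \<le> (a - b) ^ 3" if "a \<ge> 0" "b \<ge> 0" for a b :: real
proof (cases "b \<le> a")
  case True
  then show ?thesis using cube_add_le[of "a - b" b] that by simp
next
  case False
  have "0 \<le> a * b * (b - a)" using that False by simp
  moreover have "0 \<le> a ^ 3" using that by simp
  ultimately show ?thesis by (simp add: power3_eq_cube algebra_simps)
qed

text \<open>Describes one filter on an attacked signal patch: \<open>x\<close> is the clean signal,
  \<open>\<kappa>\<close> its relative rescaling by the attack along e_1, \<open>v\<close> the
  effect of the attack on the other coordinates. A fixed fraction of a positive cube survives;
  negative signals and \<open>v\<close> are charged separately.\<close>

lemma perturbed_cube_ge:
  fixes x v \<kappa> :: real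
  assumes "99 / 100 \<le> \<kappa>" "\<kappa> \<le> 101 / 100"
  shows "x ^ 3 / 32 - 8 * max 0 (- x) ^ 3 - 4 * \<bar>v\<bar> ^ 3 \<le> (\<kappa> * x + v) ^ 3"
proof (cases "x \<ge> 0")
  case True
  have "(x / 2) ^ 3 \<le> (\<kappa> * x) ^ 3" using True assms mult_right_mono[of "1/2" \<kappa> x] by (intro power3_mono) auto
  then have "x ^ 3 / 32 \<le> (\<kappa> * x) ^ 3 / 4" by (simp add: power_divide)
  moreover have "(\<kappa> * x) ^ 3 / 4 - \<bar>v\<bar> ^ 3 \<le> (\<kappa> * x - \<bar>v\<bar>) ^ 3"
    using True assms by (intro cube_diff_ge) auto
  moreover have "(\<kappa> * x - \<bar>v\<bar>) ^ 3 \<le> (\<kappa> * x + v) ^ 3" by (intro power3_mono) auto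
  moreover have "0 \<le> \<bar>v\<bar> ^ 3" "max 0 (- x) ^ 3 = 0" using True by simp_all
  ultimately show ?thesis by linarith
next
  case False
  define n where "n = - x"
  have n: "n > 0" using False by (simp add: n_def)
  have "- ((\<kappa> * n + \<bar>v\<bar>) ^ 3) = (- (\<kappa> * n + \<bar>v\<bar>)) ^ 3" by (simp add: power_minus_odd del: minus_add_distrib)
  also have "\<dots> \<le> (\<kappa> * x + v) ^ 3" by (intro power3_mono) (simp add: n_def)
  finally have "- ((\<kappa> * n + \<bar>v\<bar>) ^ 3) \<le> (\<kappa> * x + v) ^ 3" .
  moreover have "(\<kappa> * n + \<bar>v\<bar>) ^ 3 \<le> 4 * ((\<kappa> * n) ^ 3 + \<bar>v\<bar> ^ 3)"
    using n assms by (intro cube_add_le) auto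
  moreover have "(\<kappa> * n) ^ 3 \<le> 2 * n ^ 3"
  proof -
    have "\<kappa> ^ 3 \<le> (101 / 100) ^ 3" using assms by (intro power3_mono)
    also have "\<dots> \<le> (2::real)" by (simp add: power_divide)
    finally show ?thesis using n by (simp add: power_mult_distrib mult_right_mono)
  qed
  moreover have "x ^ 3 \<le> 0" using False by (simp add: power3_eq_cube mult_nonneg_nonpos mult_nonpos_nonpos)
  moreover have "max 0 (- x) ^ 3 = n ^ 3" using False by (simp add: n_def)
  ultimately show ?thesis unfolding distrib_left by linarith
qed

lemma abs_cube_eq: "\<bar>x\<bar> ^ 3 = x ^ 3 + 2 * max 0 (- x) ^ 3" for x :: real
  by (cases "x \<ge> 0") (auto simp: max_def)

subsection \<open>Gaussian noise patches\<close>

lemma normal_second_moment: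
  assumes "\<sigma> > 0"
  shows "has_bochner_integral (density lborel (normal_density 0 \<sigma>)) (\<lambda>x. x\<^sup>2) (\<sigma>\<^sup>2)"
proof -
  have "has_bochner_integral lborel (\<lambda>x. normal_density 0 \<sigma> x *\<^sub>R x\<^sup>2) (\<sigma>\<^sup>2)"
    using normal_moment_even[OF assms, of 0 1] by simp
  then show ?thesis
    by (intro has_bochner_integral_density) (auto simp: assms)
qed

text \<open>Markov's inequality for the squared norm of all noise patches together. The second
  moment of a coordinate is read off from its marginal, the pushforward of the product
  measure.\<close>

lemma noise_meas_tail:
  fixes P d :: nat and \<sigma> c :: real
  assumes "\<sigma> > 0" "c > 0"
  defines "M \<equiv> noise_meas P d \<sigma>" and "I \<equiv> {..<P} \<times> {1..<d - 1}"
  shows "measure M {Z \<in> space M. c \<le> (\<Sum>e\<in>I. (Z e)\<^sup>2)} \<le> P * d * \<sigma>\<^sup>2 / c"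
    and "{Z \<in> space M. c \<le> (\<Sum>e\<in>I. (Z e)\<^sup>2)} \<in> sets M"
    and "prob_space M"
proof -
  let ?N = "density lborel (normal_density 0 \<sigma>)"
  have N: "prob_space ?N" using assms by (intro prob_space_normal_density) auto
  have M: "M = PiM I (\<lambda>_. ?N)" by (simp add: M_def I_def noise_meas_def)
  show "prob_space M" unfolding M by (intro prob_space_PiM N)
  have meas[measurable]: "(\<lambda>Z. Z e) \<in> borel_measurable M" if "e \<in> I" for e
    using that measurable_component_singleton[of e I "\<lambda>_. ?N"] unfolding M by simp
  have comp: "has_bochner_integral M (\<lambda>Z. (Z e)\<^sup>2) (\<sigma>\<^sup>2)" if "e \<in> I" for e
  proof -
    have d: "distr M ?N (\<lambda>Z. Z e) = ?N" unfolding M using N that by (intro distr_PiM_component)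
    have m: "(\<lambda>Z. Z e) \<in> measurable M ?N"
      unfolding M by (rule measurable_component_singleton[OF that])
    have "has_bochner_integral (distr M ?N (\<lambda>Z. Z e)) (\<lambda>x. x\<^sup>2) (\<sigma>\<^sup>2)"
      unfolding d using assms by (intro normal_second_moment)
    then show ?thesis
      using m by (simp add: has_bochner_integral_iff integrable_distr_eq integral_distr)
  qed
  have S: "has_bochner_integral M (\<lambda>Z. \<Sum>e\<in>I. (Z e)\<^sup>2) (\<Sum>e\<in>I. \<sigma>\<^sup>2)"
    by (intro has_bochner_integral_sum comp)
  show "{Z \<in> space M. c \<le> (\<Sum>e\<in>I. (Z e)\<^sup>2)} \<in> sets M" by measurable
  have "measure M {Z \<in> space M. c \<le> (\<Sum>e\<in>I. (Z e)\<^sup>2)} \<le> (\<integral>Z. (\<Sum>e\<in>I. (Z e)\<^sup>2) \<partial>M) / c"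
    using has_bochner_integral_iff[THEN iffD1, OF S] assms
    by (intro integral_Markov_inequality_measure[where A = "{}"]) (auto intro!: AE_I2 sum_nonneg)
  also have "(\<integral>Z. (\<Sum>e\<in>I. (Z e)\<^sup>2) \<partial>M) = real (P * (d - 1 - 1)) * \<sigma>\<^sup>2"
    using has_bochner_integral_integral_eq[OF S] by (simp add: I_def)
  also have "\<dots> \<le> real (P * d) * \<sigma>\<^sup>2" by (intro mult_right_mono of_nat_mono) auto
  finally show "measure M {Z \<in> space M. c \<le> (\<Sum>e\<in>I. (Z e)\<^sup>2)} \<le> P * d * \<sigma>\<^sup>2 / c"
    using assms by (simp add: divide_right_mono)
qed

subsection \<open>Consequences of the parameter conditions\<close>

locale adversarial_training =
  fixes C :: real and N P d m :: nat and \<alpha> \<sigma>n \<sigma>0 \<eta> \<epsilon> \<Gamma> \<delta> :: real and T :: nat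
    and y :: "nat \<Rightarrow> real" and s :: "nat \<Rightarrow> nat" and X W :: "nat \<Rightarrow> nat \<Rightarrow> nat \<Rightarrow> real"
    and adv :: "nat \<Rightarrow> nat \<Rightarrow> real"
  assumes setting: "AT_setting C N P d m \<alpha> \<sigma>n \<sigma>0 \<eta> \<epsilon> \<Gamma> \<delta> T y s X W adv"
    and C_ge: "C \<ge> 100"
begin

text \<open>\<open>L\<close> is the logarithm of conditions (ii), (iii) and (v), \<open>L'\<close>
  the one with the extra factor d in (iv); \<open>q\<close> is the order of the norm of a noise
  patch.\<close>

definition "L = ln (real T * real N * real m * real P / \<delta>)"
definition "L' = ln (real T * real d * real N * real m * real P / \<delta>)"
definition "q = \<sigma>n * sqrt d"

text \<open>Casts are distributed over products before folding, so that the logarithms are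
  recognised as \<open>L\<close> and \<open>L'\<close>.\<close>

lemmas params = setting[unfolded AT_setting_def, THEN conjunct1, unfolded params_ok_def of_nat_mult of_nat_power, folded L_def L'_def]
lemma data:
  assumes "i < N"
  shows "y i = 1 \<or> y i = -1" "s i < P"
    "j < d \<Longrightarrow> X i (s i) j = (if j = 0 then \<alpha> * y i else 0)"
    "p < P \<Longrightarrow> p \<noteq> s i \<Longrightarrow> X i p 0 = 0"
    "p < P \<Longrightarrow> p \<noteq> s i \<Longrightarrow> X i p (d - 1) = 0"
  using setting assms unfolding AT_setting_def data_ok_def by simp_all

lemmas event_conjs = setting[unfolded AT_setting_def, THEN conjunct2, THEN conjunct2, THEN conjunct1,
    unfolded event_E_def of_nat_mult of_nat_power]

lemmas event_self = event_conjs[THEN conjunct1, rule_format]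
lemmas event_cross = event_conjs[THEN conjunct2, THEN conjunct1, rule_format]
lemmas event_init_norm = event_conjs[THEN conjunct2, THEN conjunct2, THEN conjunct2, THEN conjunct1, rule_format]
lemmas event_init_signal = event_conjs[THEN conjunct2, THEN conjunct2, THEN conjunct2, THEN conjunct2,
    THEN conjunct1, rule_format]
lemmas event_init_noise = event_conjs[THEN conjunct2, THEN conjunct2, THEN conjunct2, THEN conjunct2,
    THEN conjunct2, THEN conjunct1, rule_format]
lemmas event_max = event_conjs[THEN conjunct2, THEN conjunct2, THEN conjunct2, THEN conjunct2,
    THEN conjunct2, THEN conjunct2, THEN conjunct1]

lemma traj:
  shows "t \<le> T \<Longrightarrow> i < N \<Longrightarrow> is_adv m P d \<epsilon> (W t) (X i) (y i) (s i) (adv t i)"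
    "t < T \<Longrightarrow> r < m \<Longrightarrow> W (Suc t) r j =
         (if j = d - 1 then W t r j
          else W t r j - \<eta> / N *
            (\<Sum>i<N. grad_AT m P d (W t) (perturb (X i) (s i) (adv t i)) (y i) r j))"
  using setting unfolding AT_setting_def AT_traj_def by blast+

lemma pos: "N > 0" "d > 0" "m > 0" "P \<ge> 2" "\<alpha> > 0" "\<sigma>n > 0" "\<sigma>0 > 0" "\<eta> > 0" "\<epsilon> > 0"
    "0 < \<delta>" "\<delta> < 1"
  using params by auto

lemma q_pos: "q > 0" using pos by (simp add: q_def)

text \<open>The lower bound in (i) is positive and T is an integer.\<close>

lemma T_ge_1: "real T \<ge> 1"
proof -
  have "real T \<ge> C * N / (\<eta> * \<sigma>0 * \<sigma>n ^ 3 * d powr (3/2))" using params by blast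
  moreover have "C * N / (\<eta> * \<sigma>0 * \<sigma>n ^ 3 * d powr (3/2)) > 0" using pos C_ge by simp
  ultimately have "real T > 0" by linarith
  then show ?thesis by simp
qed

text \<open>N P / \<delta> \<ge> 2 and ln 2 \<ge> 1/2, so the lower bound on m in (viii) is at least
  C/2.\<close>

lemma m_ge: "real m \<ge> 50"
proof -
  have "2 * 1 \<le> real P * (1/\<delta>)" using pos by (intro mult_mono) auto
  moreover have "1 * (P/\<delta>) \<le> N * (P/\<delta>)" using pos by (intro mult_right_mono) auto
  ultimately have "2 \<le> real N * P / \<delta>" by simp
  then have "ln 2 \<le> ln (real N * real P / \<delta>)" by (subst ln_le_cancel_iff) auto
  moreover have "ln 2 \<ge> (1/2::real)" using ln2_ge_two_thirds by simp
  ultimately have "1/2 \<le> ln (real N * real P / \<delta>)" by linarith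
  then have "100 * (1/2) \<le> C * ln (real N * real P / \<delta>)" using C_ge by (intro mult_mono) auto
  also have "\<dots> \<le> m" using params by blast
  finally show ?thesis by simp
qed

lemma TNmP_ge: "real T * N * m * P / \<delta> \<ge> real m" 
  and TNmP_ge': "real T * N * m * P / \<delta> \<ge> real N * m * P / \<delta>"
  and TNmP_geT: "real T * N * m * P / \<delta> \<ge> real T"
proof -
  have 1: "1/\<delta> \<ge> 1" using pos by simp
  have a: "real T * N * m * P / \<delta> = (real T * N * P) * (1 / \<delta>) * m" by simp
  have "1 * 1 * 1 \<le> real T * N * P" using T_ge_1 pos by (intro mult_mono) auto
  then have "1 * 1 \<le> real T * N * P * (1 / \<delta>)" using 1 by (intro mult_mono) auto
  then show "real T * N * m * P / \<delta> \<ge> real m" unfolding a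
    using mult_right_mono[of 1 "real T * N * P * (1 / \<delta>)" "real m"] by simp
  have "1 * (real N * m * P / \<delta>) \<le> T * (real N * m * P / \<delta>)"
    using T_ge_1 pos by (intro mult_right_mono) auto
  then show "real T * N * m * P / \<delta> \<ge> real N * m * P / \<delta>" by (simp add: mult.assoc)
  have "1 * 1 * 1 \<le> real N * m * P" using m_ge pos by (intro mult_mono) auto
  then have "1 * 1 \<le> real N * m * P * (1 / \<delta>)" using 1 by (intro mult_mono) auto
  then show "real T * N * m * P / \<delta> \<ge> real T"
    using mult_left_mono[of 1 "real N * m * P * (1 / \<delta>)" "real T"] by (simp add: mult.assoc)
qed

lemma L'_eq: "L' = ln d + L"
proof -
  have "L' = ln (d * (real T * N * m * P / \<delta>))" unfolding L'_def by (simp add: mult_ac)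
  also have "\<dots> = ln d + L" unfolding L_def 
    by (intro ln_mult_pos) (use pos TNmP_ge m_ge in auto)
  finally show ?thesis .
qed

lemma L_ge_1: "L \<ge> 1"
proof -
  have "exp 1 \<le> (3::real)" by (rule exp_le)
  then have "exp 1 \<le> real T * N * m * P / \<delta>" using TNmP_ge m_ge by linarith
  moreover have "real T * N * m * P / \<delta> > 0" using TNmP_ge m_ge by linarith
  ultimately show ?thesis unfolding L_def by (subst ln_ge_iff)
qed

lemma L'_ge: "L' \<ge> L" "L' \<ge> 1" "L' \<ge> ln d"
  using L'_eq L_ge_1 pos(2) ln_ge_zero[of "real d"] by linarith+

lemma d_ge: "real d \<ge> C * (real m)\<^sup>2 * (real P)\<^sup>2 * (real N)\<^sup>2 * L ^ 4" using params by blast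

lemma ln_le_4L:
  assumes "0 < u" "u \<le> real N * m * P / \<delta>"
  shows "ln (16 * u) \<le> 4 * L"
proof -
  have "ln u \<le> L" unfolding L_def using assms TNmP_ge' by simp
  moreover have "ln (16 * u) = ln 16 + ln u" using assms by (intro ln_mult_pos) auto
  ultimately show ?thesis using ln_16_le L_ge_1 by linarith
qed

text \<open>With u = N P / \<delta> the argument is at most 16 u^2, because \<delta>^2 \<le>
  \<delta>; each factor u contributes at most L.\<close>

lemma ln_cross_le: "ln (16 * (real N)\<^sup>2 * (real P)\<^sup>2 / \<delta>) \<le> 5 * L"
proof -
  let ?u = "real N * real P / \<delta>"
  have m: "real m \<ge> 1" using m_ge by simp
  have u: "?u > 0" using pos by simp
  have "?u * 1 \<le> ?u * m" using m u by (intro mult_left_mono) linarith+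
  then have "?u \<le> real N * m * P / \<delta>" by (simp add: mult_ac)
  then have uL: "ln ?u \<le> L" unfolding L_def using u TNmP_ge' by simp
  have "16 * (real N)\<^sup>2 * (real P)\<^sup>2 / \<delta> \<le> 16 * ?u ^ 2"
  proof -
    have "\<delta> * \<delta> \<le> \<delta>" using pos by (simp add: mult_left_le)
    then show ?thesis using pos by (simp add: power2_eq_square field_simps mult_left_mono)
  qed
  then have "ln (16 * (real N)\<^sup>2 * (real P)\<^sup>2 / \<delta>) \<le> ln (16 * ?u ^ 2)" using pos u by (subst ln_le_cancel_iff) auto
  also have "\<dots> = ln 16 + 2 * ln ?u" using u pos by (subst ln_mult_pos) (auto simp: ln_realpow)
  also note ln_16_le
  finally show ?thesis using uL L_ge_1 by linarith
qed

lemma d_ge_2: "d \<ge> 2" and sqrt_d_ge: "sqrt d \<ge> 10 * P * N * L\<^sup>2" "sqrt d \<ge> P * N"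
proof -
  have e: "real d \<ge> (10 * P * N * L\<^sup>2)\<^sup>2"
  proof -
    have m2: "1 \<le> real m ^ 2" using m_ge by (intro one_le_power) simp 
    have "100 * 1 \<le> C * real m ^ 2" using C_ge m2 by (intro mult_mono) auto
    then have "100 * ((real P)\<^sup>2 * (real N)\<^sup>2 * L ^ 4) \<le> C * real m ^ 2 * ((real P)\<^sup>2 * (real N)\<^sup>2 * L ^ 4)"
      by (intro mult_right_mono) auto
    also have "\<dots> \<le> d" using d_ge by (simp add: mult_ac)
    finally show ?thesis by (simp add: power_mult_distrib mult_ac flip: power_mult)
  qed
  then show a: "sqrt d \<ge> 10 * P * N * L\<^sup>2" by (rule real_le_rsqrt)
  have "1 \<le> L\<^sup>2" using L_ge_1 by (simp add: one_le_power)
  then have "real P * N * 1 \<le> 10 * P * N * L\<^sup>2" by (intro mult_mono) auto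
  with a show b: "sqrt d \<ge> P * N" by simp
  have "real P * N \<ge> 2 * 1" using pos by (intro mult_mono) auto
  with b have "sqrt d \<ge> 2" by simp
  then have "2 * 2 \<le> sqrt d * sqrt d" by (intro mult_mono) auto
  then show "d \<ge> 2" by simp
qed

text \<open>Cubing (iii) removes the root of N. This is what lets the signal outrun the noise: N
  signal contributions of size \<alpha>^3 outweigh one noise self-interaction of size q^3.\<close>

lemma alpha_cube: "N * \<alpha> ^ 3 \<ge> (C * q * L) ^ 3"
proof -
  have "\<alpha> \<ge> C * \<sigma>n * sqrt d * L / (real N powr (1/3))" using params by blast
  then have "C * q * L \<le> \<alpha> * real N powr (1/3)" using pos by (simp add: q_def field_simps)
  then have "(C * q * L) ^ 3 \<le> (\<alpha> * real N powr (1/3)) ^ 3"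
    using C_ge q_pos L_ge_1 by (intro power_mono) auto
  also have "\<dots> = N * \<alpha> ^ 3" using pos
    by (simp add: power_mult_distrib powr_power)
  finally show ?thesis .
qed

lemma sigma0_Min: assumes "u \<in> {1 / (m powr (2/3) * P powr (2/3) * \<sigma>n * sqrt d),
                         1 / (\<alpha> * m powr (2/3)),
                         1 / (\<sigma>n * (real m)\<^sup>2 * sqrt P * d)}"
  shows "\<sigma>0 * C * L' \<le> u"
proof -
  let ?S = "{1 / (m powr (2/3) * P powr (2/3) * \<sigma>n * sqrt d),
                         1 / (\<alpha> * m powr (2/3)),
                         1 / (\<sigma>n * (real m)\<^sup>2 * sqrt P * d)}"
  have "\<sigma>0 \<le> (1 / C) * Min ?S / L'" using params by blast
  then have "\<sigma>0 * C * L' \<le> Min ?S" using C_ge L'_ge by (simp add: field_simps)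
  also have "\<dots> \<le> u" using assms by (intro Min_le) auto
  finally show ?thesis .
qed

text \<open>Cubing the first bound of (iv) turns the exponents 2/3 into squares;
  \<open>sigma0_alpha\<close> treats the second bound in the same way.\<close>

lemma sigma0_q: "(\<sigma>0 * q * C * L') ^ 3 * (real m * real P)\<^sup>2 \<le> 1"
proof -
  have "\<sigma>0 * C * L' \<le> 1 / (m powr (2/3) * P powr (2/3) * \<sigma>n * sqrt d)" by (rule sigma0_Min) simp
  then have "\<sigma>0 * q * C * L' * (real m * real P) powr (2/3) \<le> 1" 
    using pos by (simp add: q_def field_simps powr_mult)
  then have "(\<sigma>0 * q * C * L' * (real m * real P) powr (2/3)) ^ 3 \<le> 1 ^ 3"
    using pos q_pos C_ge L'_ge by (intro power_mono) auto
  moreover have "((real m * real P) powr (2/3)) ^ 3 = (real m * real P)\<^sup>2" 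
    using pos m_ge by (simp add: powr_power powr_numeral)
  ultimately show ?thesis by (simp only: power_mult_distrib) simp
qed

lemma sigma0_alpha: "(\<sigma>0 * \<alpha> * C * L') ^ 3 * (real m)\<^sup>2 \<le> 1"
proof -
  have "\<sigma>0 * C * L' \<le> 1 / (\<alpha> * m powr (2/3))" by (rule sigma0_Min) simp
  then have "\<sigma>0 * \<alpha> * C * L' * m powr (2/3) \<le> 1" 
    using pos by (simp add: field_simps)
  then have "(\<sigma>0 * \<alpha> * C * L' * m powr (2/3)) ^ 3 \<le> 1 ^ 3"
    using pos C_ge L'_ge by (intro power_mono) auto
  moreover have "(m powr (2/3)) ^ 3 = (real m)\<^sup>2" 
    using pos m_ge by (simp add: powr_power powr_numeral)
  ultimately show ?thesis by (simp only: power_mult_distrib) simp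
qed

lemma sigma0_noise: "\<sigma>0 * \<sigma>n * (real m)\<^sup>2 * sqrt P * d * C * L' \<le> 1"
proof -
  have "\<sigma>0 * C * L' \<le> 1 / (\<sigma>n * (real m)\<^sup>2 * sqrt P * d)" by (rule sigma0_Min) simp
  then show ?thesis using pos by (simp add: field_simps)
qed

lemma eta_bounds: "\<eta> * C * L * q\<^sup>2 \<le> 1" "\<eta> * C * L * \<alpha>\<^sup>2 \<le> 1"
proof -
  let ?S = "{1 / (\<alpha> ^ 3 * \<sigma>0), 1 / (\<sigma>n\<^sup>2 * d), 1 / \<alpha>\<^sup>2}"
  have "\<eta> \<le> (1 / C) * Min ?S / L" using params by blast
  then have *: "\<eta> * C * L \<le> Min ?S" using C_ge L_ge_1 by (simp add: field_simps)
  have "Min ?S \<le> 1 / (\<sigma>n\<^sup>2 * d)" "Min ?S \<le> 1 / \<alpha>\<^sup>2" by (intro Min_le; simp)+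
  with * have "\<eta> * C * L \<le> 1 / (\<sigma>n\<^sup>2 * d)" "\<eta> * C * L \<le> 1 / \<alpha>\<^sup>2" by linarith+
  then show "\<eta> * C * L * q\<^sup>2 \<le> 1" "\<eta> * C * L * \<alpha>\<^sup>2 \<le> 1"
    using pos by (auto simp: q_def field_simps)
qed

lemma eps_bounds: "\<epsilon> * C \<le> \<alpha>" "\<epsilon> * C * (m * \<sigma>0 * d) \<le> 1"
proof -
  have "\<epsilon> < (1 / C) * min \<alpha> (1 / (m * \<sigma>0 * d))" using params by blast
  then have "\<epsilon> * C \<le> min \<alpha> (1 / (m * \<sigma>0 * d))" using C_ge by (simp add: field_simps)
  then have "\<epsilon> * C \<le> \<alpha>" "\<epsilon> * C \<le> 1 / (m * \<sigma>0 * d)" by auto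
  then show "\<epsilon> * C \<le> \<alpha>" "\<epsilon> * C * (m * \<sigma>0 * d) \<le> 1" using pos by (auto simp: field_simps)
qed

lemma T_ge: "T * \<eta> * \<sigma>0 * q ^ 3 \<ge> C * N"
proof -
  have "d powr (3/2) = sqrt d ^ 3" using pos by (simp add: powr_powr flip: powr_realpow powr_half_sqrt)
  moreover have "real T \<ge> C * N / (\<eta> * \<sigma>0 * \<sigma>n ^ 3 * d powr (3/2))" using params by blast
  ultimately show ?thesis using pos by (simp add: q_def field_simps)
qed

text \<open>Condition (i) measures the horizon against the noise strength q^3;
  \<open>alpha_cube\<close> converts this to the signal strength, and the factor N cancels.\<close>

lemma T_signal: "T * \<eta> * \<sigma>0 * \<alpha> ^ 3 \<ge> C ^ 4 * L ^ 3"
proof -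
  let ?c = "T * \<eta> * \<sigma>0"
  have c: "?c \<ge> 0" using pos by simp
  have "C ^ 4 * L ^ 3 * N = (C * L) ^ 3 * (C * N)" by (simp add: power_mult_distrib power3_eq_cube power4_eq_xxxx)
  also have "\<dots> \<le> (C * L) ^ 3 * (?c * q ^ 3)"
    using T_ge C_ge L_ge_1 by (intro mult_left_mono) auto
  also have "\<dots> = ?c * (C * q * L) ^ 3" by (simp add: power_mult_distrib)
  also have "\<dots> \<le> ?c * (N * \<alpha> ^ 3)" using alpha_cube c by (intro mult_left_mono)
  finally have "C ^ 4 * L ^ 3 * N \<le> ?c * \<alpha> ^ 3 * N" by (simp add: mult_ac)
  then show ?thesis using pos by simp
qed

text \<open>Since \<eta> q^2 \<le> 1 and \<sigma>0 q C L' \<le> 1, condition (i) forces T \<ge> C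
  L'. Hence L tends to infinity with d, on which the vanishing of the errors rests.\<close>

lemma T_ge_ln: "real T \<ge> ln d"
proof -
  have "1 * 1 \<le> real m * real P" using m_ge pos by (intro mult_mono) auto
  then have "1 \<le> (real m * real P)\<^sup>2" by (intro one_le_power) simp
  then have "(\<sigma>0 * q * C * L') ^ 3 * 1 \<le> (\<sigma>0 * q * C * L') ^ 3 * (real m * real P)\<^sup>2"
    using pos q_pos C_ge L'_ge by (intro mult_left_mono) auto
  with sigma0_q have "(\<sigma>0 * q * C * L') ^ 3 \<le> 1" by linarith
  then have a: "\<sigma>0 * q * C * L' \<le> 1" using pos q_pos C_ge L'_ge by (subst (asm) power_le_one_iff) auto
  have "\<eta> * q\<^sup>2 * (1 * 1) \<le> \<eta> * q\<^sup>2 * (C * L)" using C_ge L_ge_1 pos by (intro mult_left_mono mult_mono) auto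
  then have b: "\<eta> * q\<^sup>2 \<le> 1" using eta_bounds(1) by (simp add: mult_ac)
  have "1 * 1 \<le> C * N" using C_ge pos by (intro mult_mono) auto
  also have "\<dots> \<le> T * (\<eta> * q\<^sup>2) * (\<sigma>0 * q)" using T_ge by (simp add: power2_eq_square power3_eq_cube mult_ac)
  also have "\<dots> \<le> real T * 1 * (\<sigma>0 * q)"
    by (rule mult_right_mono[OF mult_left_mono[OF b]]) (use pos q_pos in auto)
  finally have "1 * (C * L') \<le> T * (\<sigma>0 * q) * (C * L')" using C_ge L'_ge by (intro mult_right_mono) auto
  also have "\<dots> = T * (\<sigma>0 * q * C * L')" by simp
  also have "\<dots> \<le> real T * 1" using a by (intro mult_left_mono) auto
  finally have "C * L' \<le> T" by simp
  moreover have "1 * L' \<le> C * L'" using C_ge L'_ge by (intro mult_right_mono) auto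
  ultimately show ?thesis using L'_ge by linarith
qed

lemma L_ge_lnln: "ln (ln d) \<le> L"
proof (cases "ln d > 0")
  case True
  have "ln (ln d) \<le> ln (real T * N * m * P / \<delta>)"
    using True T_ge_ln TNmP_geT by (subst ln_le_cancel_iff) linarith+
  then show ?thesis by (simp add: L_def)
next
  case False
  then have "d \<le> 1" using pos by auto
  then show ?thesis using L_ge_1 d_ge_2 by simp
qed

subsection \<open>One step of adversarial training\<close>

text \<open>\<open>a\<close> is the signal strength after the attack, \<open>g\<close> the signal
  margin at unit strength, \<open>z\<close> a patch response, and \<open>\<beta>\<close> the
  effective step size shared by all filters. \<open>A\<close> bounds the noise responses at
  initialization; \<open>noise_small\<close> leaves a factor 2 of room for the bootstrap.\<close>

definition "a t i = \<alpha> + adv t i * y i"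
definition "g t = (\<Sum>r<m. (W t r 0) ^ 3)"
definition "z t r i p = ip d (W t r) (X i p)"
definition "noise t i = y i * (\<Sum>r<m. \<Sum>p\<in>{..<P} - {s i}. (z t r i p) ^ 3)"
definition "margin t i = y i * fW m P d (W t) (perturb (X i) (s i) (adv t i))"
definition "\<beta> t = \<eta> / N * (\<Sum>i<N. psi (margin t i) * a t i ^ 3)"
definition "A = 4 * \<sigma>0 * q * L"
definition "noise_small t \<longleftrightarrow> (\<forall>r<m. \<forall>i<N. \<forall>p<P. p \<noteq> s i \<longrightarrow> \<bar>z t r i p\<bar> \<le> 2 * A)"

lemma A_pos: "A > 0" using pos q_pos L_ge_1 by (simp add: A_def)

lemma y_sq: "i < N \<Longrightarrow> y i * y i = 1" and y_cube: "i < N \<Longrightarrow> y i ^ 3 = y i" and y_abs: "i < N \<Longrightarrow> \<bar>y i\<bar> = 1"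
  using data(1)[of i] by (auto simp: power3_eq_cube)

lemma s_lt: "i < N \<Longrightarrow> s i < P"
  by (rule data)

lemma signal_patch: "i < N \<Longrightarrow> j < d \<Longrightarrow> X i (s i) j = (if j = 0 then \<alpha> * y i else 0)"
  by (rule data)

lemma noise_patch_0: "i < N \<Longrightarrow> p < P \<Longrightarrow> p \<noteq> s i \<Longrightarrow> X i p 0 = 0"
  and noise_patch_last: "i < N \<Longrightarrow> p < P \<Longrightarrow> p \<noteq> s i \<Longrightarrow> X i p (d - 1) = 0"
  by (rule data; assumption)+

lemma adv_le: "t \<le> T \<Longrightarrow> i < N \<Longrightarrow> \<bar>adv t i\<bar> \<le> \<epsilon>"
  using traj(1)[of t i] by (simp add: is_adv_def)

lemma a_bounds:
  assumes "t \<le> T" "i < N"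
  shows "\<alpha> / 2 \<le> a t i" "a t i \<le> \<alpha> * (101 / 100)" "a t i > 0"
    "a t i ^ 3 \<ge> \<alpha> ^ 3 / 8" "a t i ^ 3 \<le> 2 * \<alpha> ^ 3"
proof -
  have "\<bar>adv t i * y i\<bar> \<le> \<epsilon>" using adv_le[OF assms] y_abs[OF assms(2)] by (simp add: abs_mult)
  moreover have "\<epsilon> * 100 \<le> \<epsilon> * C" using C_ge pos by (intro mult_left_mono) auto
  ultimately have h: "\<bar>adv t i * y i\<bar> \<le> \<alpha> / 100" using eps_bounds by linarith
  then show 1: "\<alpha> / 2 \<le> a t i" and 2: "a t i \<le> \<alpha> * (101 / 100)" and "a t i > 0"
    using pos unfolding a_def by linarith+
  have "(\<alpha> / 2) ^ 3 \<le> a t i ^ 3" using 1 pos by (intro power_mono) auto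
  then show "a t i ^ 3 \<ge> \<alpha> ^ 3 / 8" by (simp add: power_divide)
  have "a t i ^ 3 \<le> (\<alpha> * (101 / 100)) ^ 3" using 2 \<open>a t i > 0\<close> by (intro power_mono) auto
  also have "\<dots> \<le> 2 * \<alpha> ^ 3" using pos by (simp add: power_mult_distrib power_divide)
  finally show "a t i ^ 3 \<le> 2 * \<alpha> ^ 3" .
qed

lemma ip_signal:
  assumes "i < N"
  shows "ip d w (perturb (X i) (s i) c (s i)) = w 0 * (y i * (\<alpha> + c * y i))"
proof -
  have "ip d w (perturb (X i) (s i) c (s i)) = (\<Sum>j<d. if j = 0 then w 0 * (\<alpha> * y i + c) else 0)"
    unfolding ip_def perturb_def using signal_patch[OF assms] by (intro sum.cong) auto
  also have "\<dots> = w 0 * (\<alpha> * y i + c)" using pos by (simp add: sum.delta)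
  also have "\<alpha> * y i + c = y i * (\<alpha> + c * y i)" using y_sq[OF assms] by (simp add: algebra_simps)
  finally show ?thesis .
qed

lemma ip_noise: "p \<noteq> s i \<Longrightarrow> ip d w (perturb (X i) (s i) c p) = ip d w (X i p)"
  by (simp add: ip_def perturb_def)

lemma sum_patches: "i < N \<Longrightarrow> (\<Sum>p<P. f p) = f (s i) + (\<Sum>p\<in>{..<P} - {s i}. f p)"
  for f :: "nat \<Rightarrow> real"
  by (rule sum.remove) (auto simp: s_lt)

text \<open>On the signal patch the label enters cubed and cancels against the outer label; the
  attack leaves the noise patches untouched. This separates signal and noise.\<close>

lemma margin_perturb:
  assumes "i < N"
  shows "y i * fW m P d (W t) (perturb (X i) (s i) c) = (\<alpha> + c * y i) ^ 3 * g t + noise t i"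
proof -
  have "fW m P d (W t) (perturb (X i) (s i) c) =
     (\<Sum>r<m. (W t r 0 * (y i * (\<alpha> + c * y i))) ^ 3 + (\<Sum>p\<in>{..<P} - {s i}. (z t r i p) ^ 3))"
    unfolding fW_eq_cubes sum_patches[OF assms] ip_signal[OF assms]
    by (simp add: ip_noise z_def)
  also have "\<dots> = y i * (\<alpha> + c * y i) ^ 3 * g t + (\<Sum>r<m. \<Sum>p\<in>{..<P} - {s i}. (z t r i p) ^ 3)"
    unfolding g_def sum.distrib sum_distrib_left
    by (simp only: power_mult_distrib y_cube[OF assms]) (simp add: mult_ac)
  finally show ?thesis using y_sq[OF assms] by (simp add: noise_def algebra_simps flip: mult.assoc)
qed

lemma margin_eq: "i < N \<Longrightarrow> margin t i = a t i ^ 3 * g t + noise t i"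
  by (simp add: margin_def margin_perturb a_def)

lemma signal_margin_le:
  assumes "t \<le> T" "i < N" "k < N"
  shows "a t i ^ 3 * g t \<le> a t k ^ 3 * g t"
proof -
  \<comment> \<open>The perturbation of sample \<open>k\<close>, transported to sample \<open>i\<close>, competes with that of sample \<open>i\<close>.\<close>
  define c where "c = adv t k * y k * y i"
  have ci: "c * y i = adv t k * y k" using y_sq[OF assms(2)] by (simp add: c_def mult.assoc)
  have "\<bar>c\<bar> \<le> \<epsilon>" using adv_le[OF assms(1,3)] y_abs assms by (simp add: c_def abs_mult)
  then have "logloss (y i * fW m P d (W t) (perturb (X i) (s i) c)) \<le> logloss (margin t i)"
    using traj(1)[of t i] assms by (simp add: is_adv_def margin_def)
  then have "margin t i \<le> y i * fW m P d (W t) (perturb (X i) (s i) c)"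
    by (simp add: logloss_le_iff)
  then show ?thesis
    using assms by (simp add: margin_perturb margin_eq ci a_def)
qed

text \<open>The label occurs to the fourth power and disappears, so all samples push every filter in
  the same direction along e_1.\<close>

lemma signal_step:
  assumes "t < T" "r < m"
  shows "W (Suc t) r 0 = W t r 0 + 3 * \<beta> t * (W t r 0)\<^sup>2"
proof -
  have g: "grad_AT m P d (W t) (perturb (X i) (s i) (adv t i)) (y i) r 0
      = - (3 * (W t r 0)\<^sup>2 * (psi (margin t i) * a t i ^ 3))" if i: "i < N" for i
  proof -
    have s0: "perturb (X i) (s i) (adv t i) (s i) 0 = y i * a t i"
      using signal_patch[OF i, of 0] pos y_sq[OF i]
      by (simp add: perturb_def a_def algebra_simps)
    have n0: "perturb (X i) (s i) (adv t i) p 0 = 0" if "p \<in> {..<P} - {s i}" for p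
      using that i by (auto simp: perturb_def noise_patch_0)
    have "grad_AT m P d (W t) (perturb (X i) (s i) (adv t i)) (y i) r 0
      = - psi (margin t i) * y i * (3 * (W t r 0 * (y i * a t i))\<^sup>2 * (y i * a t i))"
      unfolding grad_AT_def phi'_sum sum_patches[OF i] margin_def
      by (simp add: n0 s0 ip_signal[OF i] a_def)
    also have "\<dots> = - (3 * (W t r 0)\<^sup>2 * (psi (margin t i) * a t i ^ 3)) * (y i * y i) * (y i * y i)"
      by (simp add: power2_eq_square power3_eq_cube)
    finally show ?thesis by (simp add: y_sq[OF i])
  qed
  have "W (Suc t) r 0 = W t r 0 - \<eta> / N *
            (\<Sum>i<N. grad_AT m P d (W t) (perturb (X i) (s i) (adv t i)) (y i) r 0)"
    using traj(2)[of t r 0] assms d_ge_2 by simp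
  also have "(\<Sum>i<N. grad_AT m P d (W t) (perturb (X i) (s i) (adv t i)) (y i) r 0)
    = - (3 * (W t r 0)\<^sup>2 * (\<Sum>i<N. psi (margin t i) * a t i ^ 3))"
    by (simp add: g sum_distrib_left sum_negf)
  finally show ?thesis by (simp add: \<beta>_def)
qed

lemma rest_step:
  assumes "t < T" "r < m" "j \<in> {1..<d}"
  shows "W (Suc t) r j = W t r j +
    (\<Sum>i<N. \<Sum>p\<in>{..<P} - {s i}. (\<eta> / N * psi (margin t i) * y i * (3 * (z t r i p)\<^sup>2)) * X i p j)"
proof (cases "j = d - 1")
  \<comment> \<open>The projection freezes this coordinate and the noise patches vanish there, so
    the common formula still holds.\<close>
  case True
  have "X i p j = 0" if "i < N" "p \<in> {..<P} - {s i}" for i p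
    using that noise_patch_last True by auto
  then have "(\<Sum>i<N. \<Sum>p\<in>{..<P} - {s i}. (\<eta> / N * psi (margin t i) * y i * (3 * (z t r i p)\<^sup>2)) * X i p j) = 0"
    by (intro sum.neutral ballI) auto
  then show ?thesis using traj(2)[of t r j] assms True by simp
next
  case False
  have g: "grad_AT m P d (W t) (perturb (X i) (s i) (adv t i)) (y i) r j
      = - psi (margin t i) * y i * (\<Sum>p\<in>{..<P} - {s i}. 3 * (z t r i p)\<^sup>2 * X i p j)" if i: "i < N" for i
  proof -
    have "perturb (X i) (s i) (adv t i) (s i) j = 0"
      using assms(3) signal_patch[OF i, of j] by (simp add: perturb_def)
    moreover have "perturb (X i) (s i) (adv t i) p j = X i p j" for p
      using assms(3) by (simp add: perturb_def)
    ultimately show ?thesis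
      unfolding grad_AT_def phi'_sum sum_patches[OF i] margin_def
      by (simp add: ip_noise z_def)
  qed
  have "W (Suc t) r j = W t r j - \<eta> / N *
            (\<Sum>i<N. grad_AT m P d (W t) (perturb (X i) (s i) (adv t i)) (y i) r j)"
    using traj(2)[of t r j] assms False by simp
  also have "(\<Sum>i<N. grad_AT m P d (W t) (perturb (X i) (s i) (adv t i)) (y i) r j)
     = (\<Sum>i<N. - psi (margin t i) * y i * (\<Sum>p\<in>{..<P} - {s i}. 3 * (z t r i p)\<^sup>2 * X i p j))"
    by (simp add: g)
  finally show ?thesis by (simp add: sum_distrib_left sum_negf mult_ac)
qed

lemma ip_rest:
  assumes "i < N" "p < P" "p \<noteq> s i"
  shows "ip d w (X i p) = (\<Sum>j\<in>{1..<d}. w j * X i p j)"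
proof -
  have "{..<d} = insert 0 {1..<d}" using pos by auto
  then show ?thesis using noise_patch_0[OF assms] by (simp add: ip_def)
qed

text \<open>The update is paired with a fixed noise patch. Coordinate 0 drops out because noise
  patches vanish there, so the signal does not feed into this recursion except through
  \<psi>.\<close>

lemma noise_step:
  assumes "t < T" "r < m" "k < N" "h < P" "h \<noteq> s k"
  shows "z (Suc t) r k h = z t r k h +
    (\<Sum>i<N. \<Sum>p\<in>{..<P} - {s i}. (\<eta> / N * psi (margin t i) * y i * (3 * (z t r i p)\<^sup>2)) * ip d (X i p) (X k h))"
proof -
  let ?c = "\<lambda>i p. \<eta> / N * psi (margin t i) * y i * (3 * (z t r i p)\<^sup>2)"
  have "z (Suc t) r k h = (\<Sum>j\<in>{1..<d}. (W t r j + (\<Sum>i<N. \<Sum>p\<in>{..<P} - {s i}. ?c i p * X i p j)) * X k h j)"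
    unfolding z_def[of "Suc t"] ip_rest[OF assms(3-5)]
    by (intro sum.cong refl) (simp add: rest_step[OF assms(1,2)])
  also have "\<dots> = z t r k h + (\<Sum>j\<in>{1..<d}. \<Sum>i<N. \<Sum>p\<in>{..<P} - {s i}. ?c i p * (X i p j * X k h j))"
    unfolding z_def[of t] ip_rest[OF assms(3-5)]
    by (simp only: distrib_right sum.distrib sum_distrib_right mult.assoc)
  also have "(\<Sum>j\<in>{1..<d}. \<Sum>i<N. \<Sum>p\<in>{..<P} - {s i}. ?c i p * (X i p j * X k h j))
    = (\<Sum>i<N. \<Sum>p\<in>{..<P} - {s i}. ?c i p * (\<Sum>j\<in>{1..<d}. X i p j * X k h j))"
    by (subst sum.swap) (simp only: sum.swap[of _ "{1..<d}"] sum_distrib_left)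
  finally show ?thesis unfolding ip_rest[OF assms(3-5)] .
qed

lemma beta_nonneg: "t \<le> T \<Longrightarrow> \<beta> t \<ge> 0"
  unfolding \<beta>_def using pos a_bounds(3)
  by (intro mult_nonneg_nonneg sum_nonneg) (auto simp: psi_nonneg less_imp_le)

lemma signal_mono:
  assumes "t' \<le> t" "t \<le> T" "r < m"
  shows "W t' r 0 \<le> W t r 0"
  using assms
proof (induction t rule: dec_induct)
  case (step n)
  then show ?case using signal_step[of n r] beta_nonneg[of n] by (auto intro: order_trans)
qed simp

lemma init_noise: 
  assumes "r < m" "i < N" "p < P" "p \<noteq> s i"
  shows "\<bar>z 0 r i p\<bar> \<le> A"
proof -
  have "ln (16 * (real N * m * P / \<delta>)) \<le> 4 * L" by (rule ln_le_4L) (use pos in auto)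
  also have "\<dots> \<le> (2 * L)\<^sup>2" using L_ge_1 by (simp add: power2_eq_square)
  finally have "sqrt (ln (16 * (real N * m * P / \<delta>))) \<le> 2 * L" using L_ge_1 by (intro real_le_lsqrt) auto
  moreover have "\<bar>z 0 r i p\<bar> \<le> 2 * \<sigma>0 * \<sigma>n * sqrt (d * ln (16 * N * m * P / \<delta>))"
    using event_init_noise assms by (simp add: z_def)
  then have "\<bar>z 0 r i p\<bar> \<le> 2 * \<sigma>0 * q * sqrt (ln (16 * (real N * m * P / \<delta>)))"
    by (simp add: q_def real_sqrt_mult mult_ac)
  ultimately have "\<bar>z 0 r i p\<bar> \<le> 2 * \<sigma>0 * q * (2 * L)"
    using mult_left_mono[of "sqrt (ln (16 * (real N * m * P / \<delta>)))" "2 * L" "2 * \<sigma>0 * q"] pos q_pos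
    by (meson order_trans mult_nonneg_nonneg less_imp_le zero_le_numeral)
  then show ?thesis by (simp add: A_def)
qed

text \<open>Condition (ii) makes sqrt d exceed 6 L N P, so that all N P cross terms together stay
  below q^2, the order of one squared norm.\<close>

lemma cross_term_le:
  assumes "i < N" "p < P" "p \<noteq> s i" "k < N" "h < P" "h \<noteq> s k" "(i, p) \<noteq> (k, h)"
  shows "\<bar>ip d (X i p) (X k h)\<bar> \<le> q\<^sup>2 / (N * P)"
proof -
  have "\<bar>ip d (X i p) (X k h)\<bar> \<le> 2 * \<sigma>n\<^sup>2 * sqrt (d * ln (16 * (real N)\<^sup>2 * (real P)\<^sup>2 / \<delta>))"
    using assms by (intro event_cross) auto
  also have "\<dots> = 2 * \<sigma>n\<^sup>2 * sqrt d * sqrt (ln (16 * (real N)\<^sup>2 * (real P)\<^sup>2 / \<delta>))"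
    by (simp add: real_sqrt_mult)
  also have "sqrt (ln (16 * (real N)\<^sup>2 * (real P)\<^sup>2 / \<delta>)) \<le> 3 * L"
  proof (rule real_le_lsqrt)
    have "5 * L \<le> 9 * (L * L)" using L_ge_1 mult_left_mono[of 1 L L] by linarith
    then show "ln (16 * (real N)\<^sup>2 * (real P)\<^sup>2 / \<delta>) \<le> (3 * L)\<^sup>2" 
      using ln_cross_le by (simp add: power2_eq_square)
  qed (use L_ge_1 in auto)
  also have "2 * \<sigma>n\<^sup>2 * sqrt d * (3 * L) \<le> 2 * \<sigma>n\<^sup>2 * sqrt d * (sqrt d / (2 * (N * P)))"
  proof (intro mult_left_mono)
    have "P * N * (6 * L) \<le> P * N * (10 * L\<^sup>2)" 
      using L_ge_1 by (intro mult_left_mono) (auto simp: power2_eq_square)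
    then have "6 * L * (P * N) \<le> sqrt d" using sqrt_d_ge by (simp add: mult_ac)
    then show "3 * L \<le> sqrt d / (2 * (N * P))" using pos by (simp add: field_simps)
  qed auto
  also have "\<dots> = q\<^sup>2 / (N * P)" by (simp add: q_def power_mult_distrib power2_eq_square)
  finally show ?thesis using pos by (simp add: mult_left_mono)
qed

lemma self_term_le:
  assumes "i < N" "p < P" "p \<noteq> s i"
  shows "\<bar>ip d (X i p) (X i p)\<bar> \<le> 3 / 2 * q\<^sup>2"
proof -
  have "ip d (X i p) (X i p) \<ge> 0" by (simp add: ip_def sum_nonneg)
  moreover have "ip d (X i p) (X i p) \<le> 3 * \<sigma>n\<^sup>2 * d / 2" using event_self[OF assms] by simp
  ultimately show ?thesis by (simp add: q_def power_mult_distrib)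
qed

subsection \<open>Bootstrap for the noise components\<close>

text \<open>At most m P cubes of size (2 A)^3 = 512 (\<sigma>0 q L)^3 are summed, and the cubed
  condition (iv) makes the total small.\<close>

lemma noise_le_half:
  assumes "noise_small t" "i < N"
  shows "\<bar>noise t i\<bar> \<le> 1 / 2"
proof -
  have z: "\<bar>z t r i p\<bar> ^ 3 \<le> (2 * A) ^ 3" if "r < m" "p \<in> {..<P} - {s i}" for r p
    using assms that by (intro power_mono) (auto simp: noise_small_def)
  have "\<bar>noise t i\<bar> \<le> (\<Sum>r<m. \<Sum>p\<in>{..<P} - {s i}. \<bar>z t r i p\<bar> ^ 3)"
    unfolding noise_def abs_mult y_abs[OF assms(2)]
    by (auto intro!: order_trans[OF sum_abs] sum_mono simp: power_abs)
  also have "\<dots> \<le> (\<Sum>r<m. \<Sum>p\<in>{..<P} - {s i}. (2 * A) ^ 3)"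
    by (intro sum_mono z) auto
  also have "\<dots> \<le> (\<Sum>r<m. \<Sum>p<P. (2 * A) ^ 3)"
    using A_pos by (intro sum_mono sum_mono2) auto
  also have "\<dots> = (2 * A) ^ 3 * (real m * P)" by simp
  also have "\<dots> = 512 * (\<sigma>0 * q * L) ^ 3 * (real m * P)"
    by (simp add: A_def power_mult_distrib)
  also have "\<dots> \<le> 1 / 2"
  proof -
    have mP: "real m * P \<ge> 1 * 1" using m_ge pos by (intro mult_mono) auto
    have "(\<sigma>0 * q * L * 100) ^ 3 \<le> (\<sigma>0 * q * C * L') ^ 3"
    proof (rule power3_mono)
      have "L * 100 \<le> L' * C" using L'_ge L_ge_1 C_ge by (intro mult_mono) auto
      then have "\<sigma>0 * q * (L * 100) \<le> \<sigma>0 * q * (L' * C)" using pos q_pos by (intro mult_left_mono) auto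
      then show "\<sigma>0 * q * L * 100 \<le> \<sigma>0 * q * C * L'" by (simp add: mult_ac)
    qed
    moreover have "real m * P \<le> (real m * P)\<^sup>2"
      using mult_left_mono[OF mP, of "real m * P"] by (simp add: power2_eq_square)
    ultimately have "(\<sigma>0 * q * L * 100) ^ 3 * (real m * P) \<le> (\<sigma>0 * q * C * L') ^ 3 * (real m * P)\<^sup>2"
      using pos q_pos C_ge L'_ge by (intro mult_mono) auto
    with sigma0_q have "(\<sigma>0 * q * L * 100) ^ 3 * (real m * P) \<le> 1" by linarith
    then show ?thesis by (simp add: power_mult_distrib)
  qed
  finally show ?thesis .
qed

text \<open>The adversary equalizes the signal margins and the noise parts differ by at most 1,
  which costs a factor e \<le> 3.\<close>

lemma psi_comparable:
  assumes "noise_small t" "t \<le> T" "i < N" "k < N"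
  shows "psi (margin t i) \<le> 3 * psi (margin t k)"
proof -
  have "margin t k \<le> margin t i + 1"
    using signal_margin_le[OF assms(2,4,3)] noise_le_half[OF assms(1,3)] noise_le_half[OF assms(1,4)]
    unfolding margin_eq[OF assms(3)] margin_eq[OF assms(4)] by linarith
  then have "psi (margin t i) \<le> exp 1 * psi (margin t k)" by (rule psi_le_exp_mult) simp
  also have "\<dots> \<le> 3 * psi (margin t k)" by (intro mult_right_mono exp_le psi_nonneg)
  finally show ?thesis .
qed

section \<open>Monotone signal coordinates and the total step size\<close>

lemma neg_part_small:
  assumes "t \<le> T"
  shows "\<alpha> ^ 3 * (\<Sum>r<m. max 0 (- W t r 0) ^ 3) \<le> 1 / 8"
proof -
  have "real m / \<delta> * (1 * 1) \<le> real m / \<delta> * (real N * real P)" using pos by (intro mult_left_mono mult_mono) auto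
  then have "ln (16 * (real m / \<delta>)) \<le> 4 * L" using pos by (intro ln_le_4L) (auto simp: mult_ac)
  then have "2 * ln (16 * m / \<delta>) \<le> 8 * L" by simp
  also have "\<dots> \<le> (3 * L)\<^sup>2" using L_ge_1 by (simp add: power2_eq_square)
  finally have "sqrt (2 * ln (16 * m / \<delta>)) \<le> 3 * L" using L_ge_1 by (intro real_le_lsqrt) auto
  then have b: "\<sigma>0 * sqrt (2 * ln (16 * m / \<delta>)) \<le> \<sigma>0 * (3 * L)" using pos by (intro mult_left_mono) auto
  have "max 0 (- W t r 0) \<le> \<sigma>0 * (3 * L)" if "r < m" for r
  proof -
    \<comment> \<open>Signal coordinates never decrease, so their negative parts are largest at
      initialization.\<close>
    have "- W t r 0 \<le> \<sigma>0 * (3 * L)"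
      using signal_mono[OF _ assms that, of 0] event_init_signal[OF that] b by simp
    then show ?thesis using pos L_ge_1 by simp
  qed
  then have "(\<Sum>r<m. max 0 (- W t r 0) ^ 3) \<le> (\<Sum>r<m. (\<sigma>0 * (3 * L)) ^ 3)"
    by (intro sum_mono power3_mono) auto
  then have "\<alpha> ^ 3 * (\<Sum>r<m. max 0 (- W t r 0) ^ 3) \<le> \<alpha> ^ 3 * (m * (\<sigma>0 * (3 * L)) ^ 3)"
    using pos by (intro mult_left_mono) auto
  also have "\<dots> = 27 * ((\<sigma>0 * \<alpha> * L) ^ 3 * m)" by (simp add: power_mult_distrib)
  also have "\<dots> \<le> 1 / 8"
  proof -
    have "(\<sigma>0 * \<alpha> * L * 100) ^ 3 \<le> (\<sigma>0 * \<alpha> * C * L') ^ 3"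
    proof (rule power3_mono)
      have "L * 100 \<le> L' * C" using L'_ge L_ge_1 C_ge by (intro mult_mono) auto
      then have "\<sigma>0 * \<alpha> * (L * 100) \<le> \<sigma>0 * \<alpha> * (L' * C)" using pos by (intro mult_left_mono) auto
      then show "\<sigma>0 * \<alpha> * L * 100 \<le> \<sigma>0 * \<alpha> * C * L'" by (simp add: mult_ac)
    qed
    moreover have "real m \<le> (real m)\<^sup>2" using m_ge by (simp add: power2_eq_square)
    ultimately have "(\<sigma>0 * \<alpha> * L * 100) ^ 3 * real m \<le> (\<sigma>0 * \<alpha> * C * L') ^ 3 * (real m)\<^sup>2"
      using pos C_ge L'_ge by (intro mult_mono) auto
    with sigma0_alpha have "(\<sigma>0 * \<alpha> * L * 100) ^ 3 * real m \<le> 1" by linarith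
    then show ?thesis by (simp add: power_mult_distrib)
  qed
  finally show ?thesis .
qed

text \<open>A single filter controls the signal margin from below, since the others cost at most
  their negative parts.\<close>

lemma signal_sum_ge:
  assumes "t \<le> T" "r < m"
  shows "\<alpha> ^ 3 * g t \<ge> (\<alpha> * W t r 0) ^ 3 - 1 / 8"
proof -
  have "g t = (W t r 0) ^ 3 + (\<Sum>k\<in>{..<m} - {r}. (W t k 0) ^ 3)"
    unfolding g_def using assms by (intro sum.remove) auto
  moreover have "(\<Sum>k\<in>{..<m} - {r}. (W t k 0) ^ 3) \<ge> (\<Sum>k\<in>{..<m} - {r}. - (max 0 (- W t k 0) ^ 3))"
    by (intro sum_mono cube_ge_neg_part)
  moreover have "(\<Sum>k\<in>{..<m} - {r}. max 0 (- W t k 0) ^ 3) \<le> (\<Sum>k<m. max 0 (- W t k 0) ^ 3)"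
    by (intro sum_mono2) auto
  ultimately have "g t \<ge> (W t r 0) ^ 3 - (\<Sum>k<m. max 0 (- W t k 0) ^ 3)"
    by (simp add: sum_negf)
  then have "\<alpha> ^ 3 * ((W t r 0) ^ 3 - (\<Sum>k<m. max 0 (- W t k 0) ^ 3)) \<le> \<alpha> ^ 3 * g t"
    using pos by (intro mult_left_mono) auto
  with neg_part_small[OF assms(1)] show ?thesis by (simp add: power_mult_distrib right_diff_distrib)
qed

text \<open>For \<open>g t \<ge> 0\<close> the attacked strength is at least \<alpha>/2, whence the
  factor 1/8. For \<open>g t < 0\<close> its cube enters with the upper bound 2 \<alpha>^3, and 2 (u
  - 1/8) suffices as u \<ge> 0.\<close>

lemma signal_margin_ge:
  assumes "t \<le> T" "i < N" "u \<ge> 0" "\<alpha> ^ 3 * g t \<ge> u - 1 / 8"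
  shows "a t i ^ 3 * g t \<ge> u / 8 - 1 / 4"
proof (cases "g t \<ge> 0")
  case True
  have "u / 8 - 1 / 4 \<le> (\<alpha> ^ 3 / 8) * g t" using assms by simp
  also have "\<dots> \<le> a t i ^ 3 * g t" using a_bounds[OF assms(1,2)] True by (intro mult_right_mono) auto
  finally show ?thesis .
next
  case False
  have "2 * \<alpha> ^ 3 * g t \<le> a t i ^ 3 * g t"
    using a_bounds[OF assms(1,2)] False by (intro mult_right_mono_neg) auto
  then show ?thesis using assms(3,4) by linarith
qed

text \<open>Every margin is at least x^3/8 - 1 for the scaled signal x of this filter, which keeps x
  \<psi> bounded; condition (v) on \<eta> \<alpha>^2 then limits the relative increase.\<close>

lemma growth_factor:
  assumes "noise_small t" "t \<le> T" "r < m" "W t r 0 \<ge> 0"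
  shows "3 * \<beta> t * W t r 0 \<le> 1"
proof -
  define x where "x = \<alpha> * W t r 0"
  have x: "x \<ge> 0" using assms pos by (simp add: x_def)
  have xpsi: "x * psi (margin t i) \<le> 6" if i: "i < N" for i
  proof -
    have "a t i ^ 3 * g t \<ge> x ^ 3 / 8 - 1 / 4"
      using signal_margin_ge[OF assms(2) i _ signal_sum_ge[OF assms(2,3)]] x by (simp add: x_def)
    then have "margin t i \<ge> x ^ 3 / 8 - 1"
      using noise_le_half[OF assms(1) i] margin_eq[OF i, of t] by linarith
    then have "exp (x ^ 3 / 8) \<le> exp (1 + margin t i)" by simp
    also have "\<dots> \<le> 3 * exp (margin t i)" unfolding exp_add by (intro mult_right_mono exp_le) simp
    finally have e: "1 + x ^ 3 / 8 \<le> 3 * (1 + exp (margin t i))" 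
      using exp_ge_add_one_self[of "x ^ 3 / 8"] unfolding distrib_left by linarith
    \<comment> \<open>With u = x/2 the first two facts combine to (u - 1)^2 (u + 2) \<ge> 0, that is
      3 u \<le> u^3 + 2.\<close>
    have "0 \<le> (x / 2) * (x / 2 - 1)\<^sup>2" using x by simp
    moreover have "0 \<le> (x / 2 - 1)\<^sup>2" by simp
    moreover have "0 \<le> x ^ 3" using x by simp
    ultimately have "x \<le> 2 + x ^ 3 / 4" by (simp add: power2_eq_square power3_eq_cube field_simps)
    with e have "x \<le> 6 * (1 + exp (margin t i))" by linarith
    then show ?thesis by (simp add: psi_eq field_simps add_pos_pos)
  qed
  have "\<beta> t * W t r 0 = \<eta> / N * (\<Sum>i<N. a t i ^ 3 * (psi (margin t i) * W t r 0))"
    by (simp add: \<beta>_def sum_distrib_left sum_distrib_right mult_ac)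
  also have "\<dots> \<le> \<eta> / N * (\<Sum>i<N. 2 * \<alpha> ^ 3 * (psi (margin t i) * W t r 0))"
    using pos assms a_bounds(5)[OF assms(2)]
    by (intro mult_left_mono sum_mono mult_right_mono) (auto simp: psi_nonneg)
  also have "\<dots> = \<eta> / N * (\<Sum>i<N. 2 * \<alpha>\<^sup>2 * (x * psi (margin t i)))"
    by (simp add: x_def power2_eq_square power3_eq_cube mult_ac)
  also have "\<dots> \<le> \<eta> / N * (\<Sum>i<N. 2 * \<alpha>\<^sup>2 * 6)"
    using pos xpsi by (intro mult_left_mono sum_mono) auto
  also have "\<dots> = 12 * (\<eta> * \<alpha>\<^sup>2)" using pos by simp
  finally have "3 * \<beta> t * W t r 0 \<le> 36 * (\<eta> * \<alpha>\<^sup>2)" by linarith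
  moreover have "\<eta> * \<alpha>\<^sup>2 * (100 * 1) \<le> \<eta> * \<alpha>\<^sup>2 * (C * L)"
    using pos C_ge L_ge_1 by (intro mult_left_mono mult_mono) auto
  ultimately show ?thesis using eta_bounds(2) by (simp add: mult_ac)
qed

lemma sum_beta_le:
  assumes "t \<le> T" "\<And>t'. t' < t \<Longrightarrow> noise_small t'"
  shows "(\<Sum>t'<t. \<beta> t') \<le> 4 / (3 * \<sigma>0)"
proof -
  \<comment> \<open>A filter attaining the maximum starts above \<sigma>0 / 2 by the event and stays
    there, so 1/w never exceeds 2 / \<sigma>0.\<close>
  have "Max ((\<lambda>r. W 0 r 0) ` {..<m}) \<in> (\<lambda>r. W 0 r 0) ` {..<m}"
    using pos by (intro Max_in) auto
  then obtain r where r: "r < m" "W 0 r 0 \<ge> \<sigma>0 / 2" using event_max by auto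
  have W: "W t' r 0 \<ge> \<sigma>0 / 2" if "t' \<le> T" for t'
    using signal_mono[of 0 t' r] r that by simp
  \<comment> \<open>\<open>1/w - 1/w' = 3 \<beta> w / w'\<close>, and \<open>w' \<le> 2 w\<close> by \<open>growth_factor\<close>.\<close>
  have "(\<Sum>t'<t. 3 / 2 * \<beta> t') \<le> (\<Sum>t'<t. 1 / W t' r 0 - 1 / W (Suc t') r 0)"
  proof (rule sum_mono)
    fix t' assume "t' \<in> {..<t}"
    then have t': "t' < t" "t' < T" using assms by auto
    define w where "w = W t' r 0"
    define b where "b = 3 * \<beta> t' * w"
    have w: "w > 0" using W[of t'] t' pos by (auto simp: w_def)
    have b0: "b \<ge> 0" using beta_nonneg[of t'] t' w by (simp add: b_def)
    have b1: "b \<le> 1" using growth_factor[of t' r] assms t' r w by (simp add: w_def b_def)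
    have "W (Suc t') r 0 = w * (1 + b)"
      using signal_step[OF t'(2) r(1)] by (simp add: w_def b_def algebra_simps power2_eq_square)
    have "1 / W t' r 0 - 1 / W (Suc t') r 0 = 3 * \<beta> t' / (1 + b)"
    proof -
      have "1 / w - 1 / (w * (1 + b)) = (b / w) / (1 + b)"
        using w b0 by (simp add: divide_simps add_nonneg_eq_0_iff)
      also have "b / w = 3 * \<beta> t'" using w by (simp add: b_def)
      finally show ?thesis by (simp add: \<open>W (Suc t') r 0 = w * (1 + b)\<close> w_def[symmetric])
    qed
    moreover have "3 * \<beta> t' / (1 + b) \<ge> 3 * \<beta> t' / 2"
      using b0 b1 beta_nonneg[of t'] t' by (intro divide_left_mono) auto
    ultimately show "3 / 2 * \<beta> t' \<le> 1 / W t' r 0 - 1 / W (Suc t') r 0" by simp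
  qed
  also have "\<dots> = 1 / W 0 r 0 - 1 / W t r 0" by (rule sum_lessThan_telescope')
  also have "\<dots> \<le> 1 / W 0 r 0" using W[OF assms(1)] pos by (smt (verit) divide_nonneg_nonneg half_gt_zero)
  also have "\<dots> \<le> 1 / (\<sigma>0 / 2)" using r pos by (intro divide_left_mono) auto
  finally have "3 / 2 * (\<Sum>t'<t. \<beta> t') \<le> 2 / \<sigma>0" by (simp add: sum_distrib_left)
  then show ?thesis using pos by (simp add: field_simps)
qed

text \<open>24 = 3 * 8: \<open>psi_comparable\<close> costs 3 and the attacked strength cubed costs
  8.\<close>

lemma beta_ge_psi:
  assumes "noise_small t" "t \<le> T" "i < N"
  shows "\<eta> * psi (margin t i) * \<alpha> ^ 3 \<le> 24 * \<beta> t"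
proof -
  have "\<eta> / N * (\<Sum>k<N. psi (margin t i) / 3 * (\<alpha> ^ 3 / 8)) \<le> \<beta> t"
    unfolding \<beta>_def using pos a_bounds(4)[OF assms(2)] psi_comparable[OF assms]
    by (intro mult_left_mono sum_mono mult_mono) (auto simp: psi_nonneg mult.commute)
  moreover have "\<eta> / N * (\<Sum>k<N. psi (margin t i) / 3 * (\<alpha> ^ 3 / 8)) = \<eta> * psi (margin t i) * \<alpha> ^ 3 / 24"
    using pos by simp
  ultimately show ?thesis by linarith
qed

section \<open>Accumulated updates along the noise patches\<close>

lemma sum_psi_le:
  assumes "t \<le> T" "\<And>t'. t' < t \<Longrightarrow> noise_small t'" "i < N"
  shows "(\<Sum>t'<t. \<eta> * psi (margin t' i)) \<le> 32 / (\<sigma>0 * \<alpha> ^ 3)"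
proof -
  have "(\<Sum>t'<t. \<eta> * psi (margin t' i)) * \<alpha> ^ 3 \<le> (\<Sum>t'<t. 24 * \<beta> t')"
    unfolding sum_distrib_right using assms by (intro sum_mono beta_ge_psi) auto
  also have "\<dots> \<le> 24 * (4 / (3 * \<sigma>0))" 
    using sum_beta_le[OF assms(1,2)] by (simp flip: sum_distrib_left)
  finally show ?thesis using pos by (simp add: field_simps)
qed

text \<open>The weights \<open>b\<close> stay general for two uses: inner products of patches in the
  bootstrap, and a constant for the norm of the filters. The constant is 3 * 4 * 32, from the
  derivative of the cube, the bound (2 A)^2 and \<open>sum_psi_le\<close>.\<close>

lemma sum_updates_le:
  assumes "t \<le> T" "\<And>t'. t' < t \<Longrightarrow> noise_small t'" "r < m"
    and b: "\<And>i p. i < N \<Longrightarrow> p \<in> {..<P} - {s i} \<Longrightarrow> b i p \<ge> 0"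
  shows "(\<Sum>t'<t. \<Sum>i<N. \<Sum>p\<in>{..<P} - {s i}. (\<eta> / N * psi (margin t' i) * (3 * (z t' r i p)\<^sup>2)) * b i p)
    \<le> 384 * A\<^sup>2 / (N * \<sigma>0 * \<alpha> ^ 3) * (\<Sum>i<N. \<Sum>p\<in>{..<P} - {s i}. b i p)"
proof -
  have zz: "(z t' r i p)\<^sup>2 \<le> 4 * A\<^sup>2" if "t' < t" "i < N" "p \<in> {..<P} - {s i}" for t' i p
  proof -
    have "\<bar>z t' r i p\<bar> ^ 2 \<le> (2 * A) ^ 2"
      using assms(2)[OF that(1)] that assms(3) by (intro power_mono) (auto simp: noise_small_def)
    then show ?thesis by (simp add: power_mult_distrib)
  qed
  have "(\<Sum>t'<t. \<Sum>i<N. \<Sum>p\<in>{..<P} - {s i}. (\<eta> / N * psi (margin t' i) * (3 * (z t' r i p)\<^sup>2)) * b i p)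
    \<le> (\<Sum>t'<t. \<Sum>i<N. \<Sum>p\<in>{..<P} - {s i}. (\<eta> / N * psi (margin t' i) * (3 * (4 * A\<^sup>2))) * b i p)"
    using pos zz b by (intro sum_mono mult_right_mono mult_left_mono mult_nonneg_nonneg) (auto simp: psi_nonneg)
  \<comment> \<open>Summing over time innermost isolates the accumulated \<psi> of each
    sample.\<close>
  also have "\<dots> = (\<Sum>i<N. \<Sum>p\<in>{..<P} - {s i}. (12 * A\<^sup>2 / N * b i p) * (\<Sum>t'<t. \<eta> * psi (margin t' i)))"
  proof -
    have "(\<Sum>t'<t. \<Sum>i<N. \<Sum>p\<in>{..<P} - {s i}. F t' i p) = (\<Sum>i<N. \<Sum>p\<in>{..<P} - {s i}. \<Sum>t'<t. F t' i p)"
      for F :: "nat \<Rightarrow> nat \<Rightarrow> nat \<Rightarrow> real"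
    proof -
      have "(\<Sum>t'<t. \<Sum>i<N. \<Sum>p\<in>{..<P} - {s i}. F t' i p) = (\<Sum>i<N. \<Sum>t'<t. \<Sum>p\<in>{..<P} - {s i}. F t' i p)"
        by (rule sum.swap)
      also have "\<dots> = (\<Sum>i<N. \<Sum>p\<in>{..<P} - {s i}. \<Sum>t'<t. F t' i p)"
        by (intro sum.cong refl sum.swap)
      finally show ?thesis .
    qed
    then show ?thesis by (simp add: sum_distrib_left sum_divide_distrib mult_ac)
  qed
  also have "\<dots> \<le> (\<Sum>i<N. \<Sum>p\<in>{..<P} - {s i}. (12 * A\<^sup>2 / N * b i p) * (32 / (\<sigma>0 * \<alpha> ^ 3)))"
    using b by (intro sum_mono mult_left_mono sum_psi_le assms mult_nonneg_nonneg) auto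
  also have "\<dots> = 384 * A\<^sup>2 / (N * \<sigma>0 * \<alpha> ^ 3) * (\<Sum>i<N. \<Sum>p\<in>{..<P} - {s i}. b i p)"
    by (simp add: sum_distrib_left sum_distrib_right sum_divide_distrib mult_ac)
  finally show ?thesis .
qed

text \<open>The total gain is a multiple of A^2 q^2 / (N \<sigma>0 \<alpha>^3). Since A is \<sigma>0
  q times a logarithm, \<open>alpha_cube\<close> absorbs one factor A q^2 into the denominator, and
  at most another A is added to the initial A.\<close>

lemma noise_small_step:
  assumes "t \<le> T" "\<And>t'. t' < t \<Longrightarrow> noise_small t'"
  shows "noise_small t"
  unfolding noise_small_def
proof (intro allI impI)
  fix r k h assume h: "r < m" "k < N" "h < P" "h \<noteq> s k"
  define D where "D t' = (\<Sum>i<N. \<Sum>p\<in>{..<P} - {s i}. 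
      (\<eta> / N * psi (margin t' i) * (3 * (z t' r i p)\<^sup>2)) * \<bar>ip d (X i p) (X k h)\<bar>)" for t'
  have step: "\<bar>z (Suc t') r k h\<bar> \<le> \<bar>z t' r k h\<bar> + D t'" if "t' < t" for t'
  proof -
    have "\<bar>\<Sum>i<N. \<Sum>p\<in>{..<P} - {s i}. (\<eta> / N * psi (margin t' i) * y i * (3 * (z t' r i p)\<^sup>2)) * ip d (X i p) (X k h)\<bar> \<le> D t'"
      unfolding D_def using pos
      by (intro order_trans[OF sum_abs] sum_mono) (auto simp: abs_mult y_abs psi_nonneg)
    then show ?thesis using noise_step[of t' r k h] that assms(1) h by linarith
  qed
  have "\<bar>z t' r k h\<bar> \<le> \<bar>z 0 r k h\<bar> + (\<Sum>t''<t'. D t'')" if "t' \<le> t" for t'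
    using that
  proof (induction t')
    case (Suc t')
    then show ?case using step[of t'] by simp
  qed simp
  then have "\<bar>z t r k h\<bar> \<le> A + (\<Sum>t''<t. D t'')" using init_noise[OF h] by force
  also have "(\<Sum>t''<t. D t'') \<le> 384 * A\<^sup>2 / (N * \<sigma>0 * \<alpha> ^ 3) *
      (\<Sum>i<N. \<Sum>p\<in>{..<P} - {s i}. \<bar>ip d (X i p) (X k h)\<bar>)"
    unfolding D_def by (intro sum_updates_le assms h) auto
  also have "\<dots> \<le> 384 * A\<^sup>2 / (N * \<sigma>0 * \<alpha> ^ 3) * (5 / 2 * q\<^sup>2)"
  proof (intro mult_left_mono)
    \<comment> \<open>The cross terms sum to at most q^2, and the single self term adds 3/2
      q^2.\<close>
    have "(\<Sum>i<N. \<Sum>p\<in>{..<P} - {s i}. \<bar>ip d (X i p) (X k h)\<bar>)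
      \<le> (\<Sum>i<N. \<Sum>p\<in>{..<P} - {s i}. q\<^sup>2 / (N * P) + (if i = k \<and> p = h then 3 / 2 * q\<^sup>2 else 0))"
      using cross_term_le[OF _ _ _ h(2-4)] self_term_le[OF h(2-4)]
      by (intro sum_mono) (auto simp: add_increasing)
    also have "\<dots> \<le> (\<Sum>i<N. \<Sum>p<P. q\<^sup>2 / (N * P) + (if i = k \<and> p = h then 3 / 2 * q\<^sup>2 else 0))"
      by (intro sum_mono sum_mono2) auto
    also have "\<dots> = q\<^sup>2 + (\<Sum>i<N. \<Sum>p<P. if i = k \<and> p = h then 3 / 2 * q\<^sup>2 else 0)"
      using pos by (simp add: sum.distrib)
    also have "(\<Sum>i<N. \<Sum>p<P. if i = k \<and> p = h then 3 / 2 * q\<^sup>2 else 0)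
        = (\<Sum>i<N. if i = k then (\<Sum>p<P. if p = h then 3 / 2 * q\<^sup>2 else 0) else 0)"
      by (intro sum.cong refl) simp
    also have "\<dots> = 3 / 2 * q\<^sup>2" using h by simp
    finally show "(\<Sum>i<N. \<Sum>p\<in>{..<P} - {s i}. \<bar>ip d (X i p) (X k h)\<bar>) \<le> 5 / 2 * q\<^sup>2" by simp
  qed (use pos in auto)
  also have "\<dots> = A * (960 * A * q\<^sup>2 / (N * \<sigma>0 * \<alpha> ^ 3))" by (simp add: power2_eq_square mult_ac)
  also have "\<dots> \<le> A * 1"
  proof (intro mult_left_mono)
    have "960 * A * q\<^sup>2 = \<sigma>0 * (3840 * L * q ^ 3)" by (simp add: A_def power2_eq_square power3_eq_cube)
    also have "\<dots> \<le> \<sigma>0 * (C * q * L) ^ 3"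
    proof (intro mult_left_mono)
      have "L * 1 \<le> L * L\<^sup>2" using L_ge_1 by (intro mult_left_mono one_le_power) auto
      moreover have "100 ^ 3 \<le> C ^ 3" using C_ge by (intro power3_mono)
      ultimately have "3840 * L * q ^ 3 \<le> C ^ 3 * (L * L\<^sup>2) * q ^ 3" 
        using L_ge_1 q_pos C_ge by (intro mult_right_mono mult_mono) auto
      then show "3840 * L * q ^ 3 \<le> (C * q * L) ^ 3"
        by (simp add: power_mult_distrib power2_eq_square power3_eq_cube mult_ac)
    qed (use pos in auto)
    also have "\<dots> \<le> \<sigma>0 * (N * \<alpha> ^ 3)" using alpha_cube pos by (intro mult_left_mono) auto
    finally show "960 * A * q\<^sup>2 / (N * \<sigma>0 * \<alpha> ^ 3) \<le> 1" using pos by (simp add: field_simps)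
  qed (use A_pos in auto)
  finally show "\<bar>z t r k h\<bar> \<le> 2 * A" by simp
qed

lemma noise_small: "t \<le> T \<Longrightarrow> noise_small t"
proof (induction t rule: less_induct)
  case (less t)
  then show ?case using noise_small_step[of t] by simp
qed

text \<open>These coordinates move by combinations of noise patches, each of norm at most 2 q. The
  triangle inequality and \<open>sum_updates_le\<close> bound the drift by \<sigma>0 P N, and P N
  \<le> sqrt d.\<close>

lemma rest_norm_le:
  assumes "t \<le> T" "r < m"
  shows "L2_set (W t r) {1..<d} \<le> 3 * \<sigma>0 * sqrt d"
proof -
  define D where "D t' = (\<Sum>i<N. \<Sum>p\<in>{..<P} - {s i}. 
      (\<eta> / N * psi (margin t' i) * (3 * (z t' r i p)\<^sup>2)) * (2 * q))" for t'
  have X: "L2_set (X i p) {1..<d} \<le> 2 * q" if "i < N" "p \<in> {..<P} - {s i}" for i p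
    unfolding L2_set_def
  proof (rule real_le_lsqrt)
    have "(\<Sum>j\<in>{1..<d}. (X i p j)\<^sup>2) = ip d (X i p) (X i p)"
      using that ip_rest[of i p "X i p"] by (simp add: power2_eq_square)
    also have "\<dots> \<le> 3 / 2 * q\<^sup>2" using self_term_le[of i p] that by auto
    also have "\<dots> \<le> (2 * q)\<^sup>2" by (simp add: power_mult_distrib)
    finally show "(\<Sum>j\<in>{1..<d}. (X i p j)\<^sup>2) \<le> (2 * q)\<^sup>2" .
  qed (use q_pos in auto)
  have step: "L2_set (W (Suc t') r) {1..<d} \<le> L2_set (W t' r) {1..<d} + D t'" if "t' < t" for t'
  proof -
    let ?c = "\<lambda>i p. \<eta> / N * psi (margin t' i) * y i * (3 * (z t' r i p)\<^sup>2)"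
    \<comment> \<open>Samples and patches are merged into one index set of pairs to match
      \<open>L2_set_sum_le\<close>.\<close>
    let ?S = "Sigma {..<N} (\<lambda>i. {..<P} - {s i})"
    have "L2_set (W (Suc t') r) {1..<d} = 
        L2_set (\<lambda>j. W t' r j + (\<Sum>ip\<in>?S. ?c (fst ip) (snd ip) * X (fst ip) (snd ip) j)) {1..<d}"
      using that assms
      by (intro L2_set_cong refl, subst rest_step) (auto simp: sum.Sigma case_prod_unfold)
    also have "\<dots> \<le> L2_set (W t' r) {1..<d} +
       L2_set (\<lambda>j. (\<Sum>ip\<in>?S. ?c (fst ip) (snd ip) * X (fst ip) (snd ip) j)) {1..<d}"
      by (rule L2_set_triangle_ineq)
    also have "L2_set (\<lambda>j. (\<Sum>ip\<in>?S. ?c (fst ip) (snd ip) * X (fst ip) (snd ip) j)) {1..<d}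
       \<le> (\<Sum>ip\<in>?S. \<bar>?c (fst ip) (snd ip)\<bar> * L2_set (\<lambda>j. X (fst ip) (snd ip) j) {1..<d})"
      by (rule L2_set_sum_le)
    also have "\<dots> \<le> (\<Sum>ip\<in>?S. (\<eta> / N * psi (margin t' (fst ip)) * (3 * (z t' r (fst ip) (snd ip))\<^sup>2)) * (2 * q))"
      using pos X by (intro sum_mono mult_mono X) (auto simp: abs_mult y_abs psi_nonneg)
    also have "\<dots> = D t'" unfolding D_def by (simp add: sum.Sigma case_prod_unfold)
    finally show ?thesis by simp
  qed
  have "L2_set (W t' r) {1..<d} \<le> L2_set (W 0 r) {1..<d} + (\<Sum>t''<t'. D t'')" if "t' \<le> t" for t'
    using that
  proof (induction t')
    case (Suc t')
    then show ?case using step[of t'] by simp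
  qed simp
  then have "L2_set (W t r) {1..<d} \<le> L2_set (W 0 r) {1..<d} + (\<Sum>t''<t. D t'')" by simp
  moreover have "L2_set (W 0 r) {1..<d} \<le> 2 * \<sigma>0 * sqrt d"
  proof -
    have "L2_set (W 0 r) {1..<d} \<le> sqrt (ip d (W 0 r) (W 0 r))"
      unfolding L2_set_def ip_def
      by (intro real_sqrt_le_mono, subst power2_eq_square, intro sum_mono2) auto
    then show ?thesis using event_init_norm[OF assms(2)] by linarith
  qed
  moreover have "(\<Sum>t''<t. D t'') \<le> \<sigma>0 * sqrt d"
  proof -
    have "(\<Sum>t''<t. D t'') \<le> 384 * A\<^sup>2 / (N * \<sigma>0 * \<alpha> ^ 3) * (\<Sum>i<N. \<Sum>p\<in>{..<P} - {s i}. 2 * q)"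
      unfolding D_def using assms q_pos by (intro sum_updates_le noise_small) auto
    also have "\<dots> \<le> 384 * A\<^sup>2 / (N * \<sigma>0 * \<alpha> ^ 3) * (\<Sum>i<N. \<Sum>p<P. 2 * q)"
      using pos q_pos by (intro mult_left_mono sum_mono sum_mono2) auto
    also have "\<dots> = \<sigma>0 * (P * (12288 * q ^ 3 * L\<^sup>2)) / \<alpha> ^ 3"
      using pos by (simp add: A_def power2_eq_square power3_eq_cube mult_ac)
    also have "\<dots> \<le> \<sigma>0 * (P * (N * \<alpha> ^ 3)) / \<alpha> ^ 3"
    proof -
      have "L\<^sup>2 * 1 \<le> L\<^sup>2 * L" using L_ge_1 by (intro mult_left_mono) auto
      moreover have "100 ^ 3 \<le> C ^ 3" using C_ge by (intro power3_mono)
      ultimately have "12288 * L\<^sup>2 * q ^ 3 \<le> C ^ 3 * (L\<^sup>2 * L) * q ^ 3" 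
        using L_ge_1 q_pos C_ge by (intro mult_right_mono mult_mono) auto
      also have "\<dots> = (C * q * L) ^ 3"
        by (simp add: power_mult_distrib power2_eq_square power3_eq_cube mult_ac)
      also note alpha_cube
      finally show ?thesis using pos by (intro divide_right_mono mult_left_mono) (auto simp: mult_ac)
    qed
    also have "\<dots> = \<sigma>0 * (P * N)" using pos by simp
    also have "\<dots> \<le> \<sigma>0 * sqrt d" using sqrt_d_ge pos by (intro mult_left_mono) auto
    finally show ?thesis .
  qed
  ultimately show ?thesis by linarith
qed

subsection \<open>Signal growth and errors\<close>

text \<open>The clean signal margin after training; its sign is settled in
  \<open>G_ge_1\<close>.\<close>

definition "G = \<alpha> ^ 3 * g T"

lemma g_mono: "t \<le> T \<Longrightarrow> g t \<le> g T"
  unfolding g_def by (intro sum_mono power3_mono signal_mono) auto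

text \<open>As \<open>g\<close> is nondecreasing, no margin exceeds 2 max(0, G) + 1/2, so each step
  size is at least of order \<eta> \<alpha>^3 e^(-2 max(0, G)). T such steps must fit into the bound
  of \<open>sum_beta_le\<close>, while T is large by \<open>T_signal\<close>.\<close>

lemma exp_G_ge: "C ^ 4 * L ^ 3 \<le> 128 / 3 * exp (2 * max 0 G)"
proof -
  define E where "E = exp (2 * max 0 G)"
  have E: "E \<ge> 1" by (simp add: E_def)
  have b: "\<eta> * \<alpha> ^ 3 / (32 * E) \<le> \<beta> t" if t: "t < T" for t
  proof -
    have tT: "t \<le> T" using t by simp
    have psi: "1 / (4 * E) \<le> psi (margin t i)" if i: "i < N" for i
    proof -
      have "a t i ^ 3 * g t \<le> a t i ^ 3 * max 0 (g T)"
        using g_mono[OF tT] a_bounds(3)[OF tT i] by (intro mult_left_mono) auto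
      also have "\<dots> \<le> 2 * \<alpha> ^ 3 * max 0 (g T)" using a_bounds(5)[OF tT i] by (intro mult_right_mono) auto
      also have "\<dots> = 2 * max 0 G" using pos by (simp add: G_def max_mult_distrib_left)
      finally have "margin t i \<le> 2 * max 0 G + 1 / 2"
        using noise_le_half[OF noise_small[OF tT] i] margin_eq[OF i, of t] by linarith
      then have "exp (margin t i) \<le> exp (2 * max 0 G + 1 / 2)" by simp
      also have "\<dots> = E * exp (1 / 2)" by (simp add: E_def exp_add)
      also have "\<dots> \<le> E * 3"
        using E exp_le by (intro mult_left_mono) (auto intro: order_trans[of _ "exp 1"])
      finally have "1 + exp (margin t i) \<le> 4 * E" using E by linarith
      then show ?thesis unfolding psi_eq by (intro divide_left_mono) (use E in \<open>auto simp: add_pos_pos\<close>)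
    qed
    have "\<eta> * \<alpha> ^ 3 / (32 * E) = \<eta> / N * (\<Sum>i<N. 1 / (4 * E) * (\<alpha> ^ 3 / 8))"
      using pos by simp
    also have "\<dots> \<le> \<beta> t" unfolding \<beta>_def using pos psi a_bounds(4)[OF tT] E
      by (intro mult_left_mono sum_mono mult_mono) (auto simp: psi_nonneg)
    finally show ?thesis .
  qed
  have "T * (\<eta> * \<alpha> ^ 3 / (32 * E)) = (\<Sum>t<T. \<eta> * \<alpha> ^ 3 / (32 * E))" by simp
  also have "\<dots> \<le> (\<Sum>t<T. \<beta> t)" using b by (intro sum_mono) auto
  also have "\<dots> \<le> 4 / (3 * \<sigma>0)" by (intro sum_beta_le noise_small) auto
  finally have "T * \<eta> * \<sigma>0 * \<alpha> ^ 3 \<le> 128 / 3 * E" using E pos by (simp add: field_simps)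
  with T_signal show ?thesis unfolding E_def by linarith
qed

text \<open>With C \<ge> 100 the preceding bound gives 1000 L^3 \<le> e^(2 max(0, G)). This
  dominates e^2, which forces G \<ge> 1, and L^2, which gives the logarithmic bound.\<close>

lemma G_ge_1: "G \<ge> 1" and G_ge_lnL: "G \<ge> ln L"
proof -
  have "100 ^ 4 \<le> C ^ 4" using C_ge by (intro power_mono) auto
  then have "100 ^ 4 * L ^ 3 \<le> C ^ 4 * L ^ 3" using L_ge_1 by (intro mult_right_mono) auto
  with exp_G_ge have "100 ^ 4 * L ^ 3 \<le> 128 / 3 * exp (2 * max 0 G)" by linarith
  moreover have "1 \<le> L ^ 3" using L_ge_1 by (intro one_le_power)
  ultimately have E: "1000 * L ^ 3 \<le> exp (2 * max 0 G)" by simp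
  have "exp 2 = exp 1 * (exp 1 :: real)" by (simp flip: exp_add)
  also have "\<dots> \<le> 3 * 3" by (intro mult_mono exp_le) auto
  also have "\<dots> \<le> exp (2 * max 0 G)" using E \<open>1 \<le> L ^ 3\<close> by linarith
  finally have "2 \<le> 2 * max 0 G" by simp
  then show G1: "G \<ge> 1" by linarith
  have "exp (2 * ln L) = L\<^sup>2" using L_ge_1 by (simp add: exp_double)
  also have "\<dots> \<le> L ^ 3" using L_ge_1 by (intro power_increasing) auto
  also have "\<dots> \<le> exp (2 * max 0 G)" using E \<open>1 \<le> L ^ 3\<close> by linarith
  finally have "2 * ln L \<le> 2 * max 0 G" by simp
  then show "G \<ge> ln L" using G1 by simp
qed

lemma G_eq: "G = (\<Sum>r<m. (\<alpha> * W T r 0) ^ 3)"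
  by (simp add: G_def g_def sum_distrib_left power_mult_distrib)

text \<open>If all scaled signals were below 1/m, their m cubes would sum to less than 1, against
  \<open>G_ge_1\<close>.\<close>

lemma signal_learned: "\<exists>r<m. 1 / m \<le> \<alpha> * W T r 0"
proof (rule ccontr)
  assume "\<not> ?thesis"
  then have "\<alpha> * W T r 0 \<le> 1 / m" if "r < m" for r using that by force
  then have "G \<le> (\<Sum>r<m. (1 / real m) ^ 3)" unfolding G_eq by (intro sum_mono power3_mono) auto
  also have "\<dots> = (1 / real m)\<^sup>2" using m_ge by (simp add: power2_eq_square power3_eq_cube)
  also have "\<dots> < 1" using m_ge by (simp add: power_less_one_iff abs_less_iff power_divide)
  finally show False using G_ge_1 by simp
qed

text \<open>Turns the bound on m in (viii) into a natural power of L', rounding the exponent up as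
  L' \<ge> 1. Thus 1/m is of order 1 up to polylogarithmic factors.\<close>

lemma m_le_polylog: "m \<le> C * L' ^ nat \<lceil>C\<rceil>"
proof -
  have "real m \<le> C * (ln d powr C)" using params by blast
  also have "ln d powr C \<le> L' powr C" using L'_ge pos C_ge by (intro powr_mono2) auto
  also have "\<dots> \<le> L' powr (nat \<lceil>C\<rceil>)" using L'_ge C_ge by (intro powr_mono) (linarith, simp)
  also have "\<dots> = L' ^ nat \<lceil>C\<rceil>" using L'_ge by (subst powr_realpow) auto
  finally show ?thesis using C_ge by simp
qed

section \<open>Robust training and test error\<close>

lemma train_err_le: "rob_train_err N P d m T y s X W adv \<le> exp (1 - G / 8)"
proof -
  have "logloss (margin T i) \<le> exp (1 - G / 8)" if i: "i < N" for i
  proof -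
    have "a T i ^ 3 * g T \<ge> G / 8 - 1 / 4"
      using G_ge_1 by (intro signal_margin_ge[OF _ i]) (auto simp: G_def)
    then have "margin T i \<ge> G / 8 - 1"
      using noise_le_half[OF noise_small i, of T] margin_eq[OF i, of T] by force
    then show ?thesis by (intro order_trans[OF logloss_le_exp]) auto
  qed
  then have "(\<Sum>i<N. logloss (margin T i)) \<le> (\<Sum>i<N. exp (1 - G / 8))" by (intro sum_mono) auto
  then show ?thesis using pos unfolding rob_train_err_def margin_def by (simp add: divide_le_eq mult.commute)
qed

text \<open>The l_1 norm of these weights is at most sqrt d times their l_2 norm, hence of order
  \<sigma>0 d, and (vi) bounds \<epsilon> by 1 / (C m \<sigma>0 d).\<close>

lemma rest_perturbation_le:
  assumes "r < m" "\<And>j. j < d \<Longrightarrow> \<bar>v j\<bar> \<le> \<epsilon>"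
  shows "\<bar>\<Sum>j\<in>{1..<d}. W T r j * v j\<bar> \<le> 1 / m"
proof -
  have "\<bar>\<Sum>j\<in>{1..<d}. W T r j * v j\<bar> \<le> (\<Sum>j\<in>{1..<d}. \<bar>W T r j\<bar> * \<epsilon>)"
    using assms by (intro order_trans[OF sum_abs] sum_mono) (auto simp: abs_mult intro: mult_left_mono)
  also have "\<dots> = (\<Sum>j\<in>{1..<d}. \<bar>W T r j\<bar>) * \<epsilon>" by (simp add: sum_distrib_right)
  also have "\<dots> \<le> (sqrt d * (3 * \<sigma>0 * sqrt d)) * \<epsilon>"
    using rest_norm_le[OF order_refl assms(1)] pos
    by (intro mult_right_mono order_trans[OF sum_abs_le_L2] mult_left_mono) auto
  also have "\<dots> = 3 * \<sigma>0 * d * \<epsilon>" by simp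
  also have "\<dots> \<le> 1 / m"
  proof -
    have "\<epsilon> * 3 * (m * \<sigma>0 * d) \<le> \<epsilon> * C * (m * \<sigma>0 * d)"
      using C_ge pos by (intro mult_right_mono mult_left_mono) auto
    with eps_bounds(2) have "\<epsilon> * 3 * (m * \<sigma>0 * d) \<le> 1" by linarith
    then show ?thesis using pos by (simp add: field_simps)
  qed
  finally show ?thesis .
qed

text \<open>The margin is estimated filter by filter. The radius for \<open>Z\<close> is the one at
  which Cauchy-Schwarz with \<open>rest_norm_le\<close> gives a noise response of at most 1/m, like
  the attack outside coordinate 0; summed over m filters these errors cost a constant.\<close>

lemma robust_margin_ge:
  assumes y': "y' \<in> {1, -1 :: real}" and s': "s' < P"
    and Z: "(\<Sum>e\<in>{..<P} \<times> {1..<d - 1}. (Z e)\<^sup>2) \<le> 1 / (9 * (real m)\<^sup>2 * \<sigma>0\<^sup>2 * d)"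
    and \<Delta>: "\<And>p j. p < P \<Longrightarrow> j < d \<Longrightarrow> \<bar>\<Delta> p j\<bar> \<le> \<epsilon>"
  shows "y' * fW m P d (W T) (\<lambda>p j. test_pt d \<alpha> y' s' Z p j + \<Delta> p j) \<ge> G / 64 - (2 + 36 * C)"
proof -
  define Xt where "Xt = (\<lambda>p j. test_pt d \<alpha> y' s' Z p j + \<Delta> p j)"
  have yy: "y' * y' = 1" and y3: "y' ^ 3 = y'" and ya: "\<bar>y'\<bar> = 1" using y' by (auto simp: power3_eq_cube)
  have split0: "ip d w x = w 0 * x 0 + (\<Sum>j\<in>{1..<d}. w j * x j)" for w x
  proof -
    have "{..<d} = insert 0 {1..<d}" using pos by auto
    then show ?thesis by (simp add: ip_def)
  qed
  have eps: "\<epsilon> \<le> \<alpha> / C" using eps_bounds(1) C_ge by (simp add: field_simps)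
  have eps100: "\<epsilon> \<le> \<alpha> / 100"
    using eps C_ge pos by (elim order_trans) (intro divide_left_mono, auto)
  have m1: "real m \<ge> 1" using m_ge by simp
  have row: "(\<alpha> * W T r 0) ^ 3 / 64 - 9 * max 0 (- (\<alpha> * W T r 0)) ^ 3 - 36 * C / m
      \<le> y' * (\<Sum>p<P. (ip d (W T r) (Xt p)) ^ 3)" if r: "r < m" for r
  proof -
    define x where "x = \<alpha> * W T r 0"
    define n where "n = max 0 (- x)"
    have sig: "x ^ 3 / 32 - 8 * n ^ 3 - 4 * (1 / m) ^ 3 \<le> y' * (ip d (W T r) (Xt s')) ^ 3"
    proof -
      define v where "v = y' * (\<Sum>j\<in>{1..<d}. W T r j * \<Delta> s' j)"
      define \<kappa> where "\<kappa> = 1 + y' * \<Delta> s' 0 / \<alpha>"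
      have v: "\<bar>v\<bar> \<le> 1 / m"
        using rest_perturbation_le[OF r, of "\<Delta> s'"] \<Delta> s' by (simp add: v_def abs_mult ya)
      have "\<bar>y' * \<Delta> s' 0\<bar> \<le> \<alpha> / 100" using \<Delta>[OF s', of 0] pos eps100 by (simp add: abs_mult ya)
      then have "\<bar>y' * \<Delta> s' 0 / \<alpha>\<bar> \<le> 1 / 100" using pos by (simp add: abs_divide field_simps)
      then have \<kappa>: "99 / 100 \<le> \<kappa>" "\<kappa> \<le> 101 / 100" unfolding \<kappa>_def by linarith+
      have "(\<Sum>j\<in>{1..<d}. W T r j * Xt s' j) = (\<Sum>j\<in>{1..<d}. W T r j * \<Delta> s' j)"
        by (intro sum.cong) (auto simp: Xt_def test_pt_def)
      then have "ip d (W T r) (Xt s') = W T r 0 * (\<alpha> * y' + \<Delta> s' 0) + y' * v"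
        by (simp add: split0 Xt_def test_pt_def v_def yy flip: mult.assoc)
      also have "\<dots> = y' * (\<kappa> * x + v)"
        using pos yy by (simp add: \<kappa>_def x_def field_simps)
      finally have "y' * (ip d (W T r) (Xt s')) ^ 3 = (\<kappa> * x + v) ^ 3"
        by (simp add: power_mult_distrib y3 yy flip: mult.assoc)
      moreover have "\<bar>v\<bar> ^ 3 \<le> (1 / m) ^ 3" using v by (intro power3_mono)
      ultimately show ?thesis using perturbed_cube_ge[OF \<kappa>, of x v] unfolding n_def by linarith
    qed
    have noi: "- (4 * (\<bar>x\<bar> ^ 3 / C ^ 3 + 8 * (1 / m) ^ 3)) \<le> y' * (ip d (W T r) (Xt p)) ^ 3"
      if p: "p < P" "p \<noteq> s'" for p
    proof -
      define v1 where "v1 = (\<Sum>j\<in>{1..<d}. W T r j * \<Delta> p j)"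
      define v2 where "v2 = (\<Sum>j\<in>{1..<d}. W T r j * test_pt d \<alpha> y' s' Z p j)"
      have "\<bar>v1\<bar> \<le> 1 / m"
        unfolding v1_def using rest_perturbation_le[OF r, of "\<Delta> p"] \<Delta> p by simp
      moreover have "\<bar>v2\<bar> \<le> 1 / m"
      proof -
        have "\<bar>v2\<bar> \<le> (\<Sum>j\<in>{1..<d}. \<bar>W T r j\<bar> * \<bar>test_pt d \<alpha> y' s' Z p j\<bar>)"
          unfolding v2_def by (intro order_trans[OF sum_abs]) (simp add: abs_mult)
        also have "\<dots> \<le> L2_set (W T r) {1..<d} * L2_set (test_pt d \<alpha> y' s' Z p) {1..<d}"
          by (rule L2_set_mult_ineq)
        also have "L2_set (test_pt d \<alpha> y' s' Z p) {1..<d} \<le> 1 / (3 * m * \<sigma>0 * sqrt d)"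
          unfolding L2_set_def
        proof (rule real_le_lsqrt)
          have "(\<Sum>j\<in>{1..<d}. (test_pt d \<alpha> y' s' Z p j)\<^sup>2) = (\<Sum>j\<in>{1..<d - 1}. (Z (p, j))\<^sup>2)"
            using p by (intro sum.mono_neutral_cong_right) (auto simp: test_pt_def)
          also have "\<dots> = (\<Sum>e\<in>{p} \<times> {1..<d - 1}. (Z e)\<^sup>2)"
            by (rule sum.reindex_bij_witness[of _ snd "Pair p"]) auto
          also have "\<dots> \<le> (\<Sum>e\<in>{..<P} \<times> {1..<d - 1}. (Z e)\<^sup>2)"
            using p by (intro sum_mono2) auto
          also note Z
          finally show "(\<Sum>j\<in>{1..<d}. (test_pt d \<alpha> y' s' Z p j)\<^sup>2) \<le> (1 / (3 * m * \<sigma>0 * sqrt d))\<^sup>2"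
            using pos by (simp add: power_divide power_mult_distrib mult_ac)
        qed (use pos in auto)
        also have "L2_set (W T r) {1..<d} * (1 / (3 * m * \<sigma>0 * sqrt d))
            \<le> (3 * \<sigma>0 * sqrt d) * (1 / (3 * m * \<sigma>0 * sqrt d))"
          using rest_norm_le[OF order_refl r] pos by (intro mult_right_mono) auto
        also have "\<dots> = 1 / m" using pos by simp
        finally show ?thesis by (simp add: mult_left_mono L2_set_nonneg)
      qed
      ultimately have v: "\<bar>v1 + v2\<bar> \<le> 2 / m" by simp
      \<comment> \<open>On a noise patch the attacker can plant a fake signal along e_1, but of
        relative size at most 1/C.\<close>
      have u: "\<bar>W T r 0 * \<Delta> p 0\<bar> \<le> \<bar>x\<bar> / C"
      proof -
        have "\<bar>\<Delta> p 0\<bar> \<le> \<alpha> / C" using \<Delta>[OF p(1), of 0] pos eps by simp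
        then have "\<bar>W T r 0\<bar> * \<bar>\<Delta> p 0\<bar> \<le> \<bar>W T r 0\<bar> * (\<alpha> / C)" by (intro mult_left_mono) auto
        then show ?thesis using pos by (simp add: x_def abs_mult mult_ac)
      qed
      have "ip d (W T r) (Xt p) = W T r 0 * \<Delta> p 0 + (v1 + v2)"
        using p by (simp add: split0 Xt_def test_pt_def v1_def v2_def distrib_left sum.distrib)
      then have "\<bar>ip d (W T r) (Xt p)\<bar> ^ 3 \<le> (\<bar>x\<bar> / C + 2 / m) ^ 3"
        using u v by (intro power3_mono) linarith
      also have "\<dots> \<le> 4 * ((\<bar>x\<bar> / C) ^ 3 + (2 / m) ^ 3)" using C_ge by (intro cube_add_le) auto
      also have "\<dots> = 4 * (\<bar>x\<bar> ^ 3 / C ^ 3 + 8 * (1 / m) ^ 3)" by (simp add: power_divide)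
      finally have "\<bar>y' * (ip d (W T r) (Xt p)) ^ 3\<bar> \<le> 4 * (\<bar>x\<bar> ^ 3 / C ^ 3 + 8 * (1 / m) ^ 3)"
        by (simp add: abs_mult ya power_abs)
      then show ?thesis by linarith
    qed
    define B where "B = 4 * (\<bar>x\<bar> ^ 3 / C ^ 3 + 8 * (1 / m) ^ 3)"
    have B0: "B \<ge> 0" using C_ge by (simp add: B_def)
    have PC: "real P \<le> C" using params by blast
    have "y' * (\<Sum>p<P. (ip d (W T r) (Xt p)) ^ 3) =
        y' * (ip d (W T r) (Xt s')) ^ 3 + (\<Sum>p\<in>{..<P} - {s'}. y' * (ip d (W T r) (Xt p)) ^ 3)"
      using s' by (simp add: sum_distrib_left distrib_left sum.remove[of "{..<P}" s'])
    moreover have "(\<Sum>p\<in>{..<P} - {s'}. y' * (ip d (W T r) (Xt p)) ^ 3) \<ge> (\<Sum>p\<in>{..<P} - {s'}. - B)"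
      using noi by (intro sum_mono) (auto simp: B_def)
    moreover have "(\<Sum>p\<in>{..<P} - {s'}. B) \<le> (\<Sum>p<P. B)" using B0 by (intro sum_mono2) auto
    moreover have "(\<Sum>p<P. B) \<le> C * B" using PC B0 by (simp add: mult_right_mono)
    ultimately have tot: "x ^ 3 / 32 - 8 * n ^ 3 - 4 * (1 / m) ^ 3 - C * B \<le> y' * (\<Sum>p<P. (ip d (W T r) (Xt p)) ^ 3)"
      using sig by (simp add: sum_negf)
    have m3: "(1 / real m) ^ 3 \<le> 1 / m"
      using m1 by (simp add: power_divide divide_simps self_le_power)
    have "C * B = (4 / C\<^sup>2) * \<bar>x\<bar> ^ 3 + 32 * C * (1 / m) ^ 3"
      using C_ge by (simp add: B_def power2_eq_square power3_eq_cube field_simps)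
    \<comment> \<open>At most C patches carry a planted signal, each costing 4 |x|^3 / C^3. For C
      \<ge> 100 this takes at most half of the x^3 / 32 gained on the signal patch, up to negative
      parts.\<close>
    also have "(4 / C\<^sup>2) * \<bar>x\<bar> ^ 3 \<le> (1 / 64) * \<bar>x\<bar> ^ 3"
    proof (intro mult_right_mono)
      have "100\<^sup>2 \<le> C\<^sup>2" using C_ge by (intro power_mono) auto
      then show "4 / C\<^sup>2 \<le> 1 / 64" using C_ge by (simp add: field_simps)
    qed auto
    also have "\<bar>x\<bar> ^ 3 = x ^ 3 + 2 * n ^ 3" by (simp add: n_def abs_cube_eq)
    also have "32 * C * (1 / m) ^ 3 \<le> 32 * C * (1 / m)" using m3 C_ge by (intro mult_left_mono) auto
    finally have CB: "C * B \<le> x ^ 3 / 64 + n ^ 3 / 32 + 32 * (C / m)" by (simp add: distrib_left)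
    have "4 * (1 / real m) ^ 3 \<le> 4 * (C / m)"
      using m3 C_ge m1 by (intro mult_left_mono order_trans[OF m3] divide_right_mono) auto
    moreover have "n ^ 3 \<ge> 0" by (simp add: n_def)
    moreover have "36 * C / m = 36 * (C / m)" by simp
    ultimately have "x ^ 3 / 64 - 9 * n ^ 3 - 36 * C / m \<le> x ^ 3 / 32 - 8 * n ^ 3 - 4 * (1 / m) ^ 3 - C * B"
      using CB by linarith
    with tot show ?thesis unfolding x_def n_def by linarith
  qed
  have "(\<Sum>r<m. (\<alpha> * W T r 0) ^ 3 / 64 - 9 * max 0 (- (\<alpha> * W T r 0)) ^ 3 - 36 * C / m)
     = G / 64 - 9 * (\<Sum>r<m. max 0 (- (\<alpha> * W T r 0)) ^ 3) - 36 * C"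
    using m1 by (simp add: G_eq sum_subtractf sum_divide_distrib sum_distrib_left)
  moreover have "(\<Sum>r<m. max 0 (- (\<alpha> * W T r 0)) ^ 3) \<le> 1 / 8"
  proof -
    have "max 0 (- (\<alpha> * W T r 0)) = \<alpha> * max 0 (- W T r 0)" for r
      using pos by (simp add: max_mult_distrib_left)
    then show ?thesis using neg_part_small[of T] by (simp add: power_mult_distrib sum_distrib_left)
  qed
  moreover have "(\<Sum>r<m. (\<alpha> * W T r 0) ^ 3 / 64 - 9 * max 0 (- (\<alpha> * W T r 0)) ^ 3 - 36 * C / m)
    \<le> (\<Sum>r<m. y' * (\<Sum>p<P. (ip d (W T r) (Xt p)) ^ 3))"
    using row by (intro sum_mono) auto
  moreover have "(\<Sum>r<m. y' * (\<Sum>p<P. (ip d (W T r) (Xt p)) ^ 3)) = y' * fW m P d (W T) Xt"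
    by (simp add: fW_eq_cubes sum_distrib_left)
  ultimately show ?thesis unfolding Xt_def[symmetric] by linarith
qed

text \<open>The threshold on G is 64 (2 + 36 C), which makes the bound of
  \<open>robust_margin_ge\<close> nonnegative. A failure then needs noise beyond the radius, an
  event made rare by the last bound of (iv).\<close>

lemma test_err_le:
  assumes "G \<ge> 128 + 2304 * C" "ln d > 0"
  shows "rob_test_err m P d \<alpha> \<sigma>n \<epsilon> (W T) \<le> 1 / ln d"
proof -
  let ?M = "noise_meas P d \<sigma>n"
  define c where "c = 1 / (9 * (real m)\<^sup>2 * \<sigma>0\<^sup>2 * d)"
  have c: "c > 0" using pos by (simp add: c_def)
  note tail = noise_meas_tail[OF pos(6) c, of P d]
  interpret prob_space ?M by (rule tail(3))
  let ?B = "{Z \<in> space ?M. c \<le> (\<Sum>e\<in>{..<P} \<times> {1..<d - 1}. (Z e)\<^sup>2)}"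
  have "measure ?M ?B \<le> P * d * \<sigma>n\<^sup>2 / c" by (rule tail(1))
  also have "\<dots> = 9 * (\<sigma>0 * \<sigma>n * m * sqrt P * d)\<^sup>2"
    by (simp add: c_def power_mult_distrib power2_eq_square)
  also have "\<dots> \<le> 9 * (1 / (100 * L'))\<^sup>2"
  proof (intro mult_left_mono power_mono)
    let ?u = "\<sigma>0 * \<sigma>n * m * sqrt P * d"
    have u: "?u \<ge> 0" using pos by simp
    have "1 * (100 * L') \<le> m * (C * L')" using m_ge C_ge L'_ge by (intro mult_mono) auto
    then have "?u * (100 * L') \<le> ?u * (m * (C * L'))" using u by (intro mult_left_mono) auto
    also have "\<dots> = \<sigma>0 * \<sigma>n * m\<^sup>2 * sqrt P * d * C * L'" by (simp add: power2_eq_square)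
    also have "\<dots> \<le> 1" using sigma0_noise by simp
    finally show "?u \<le> 1 / (100 * L')" using L'_ge by (simp add: field_simps)
  qed (use pos in auto)
  also have "\<dots> \<le> 1 / L'"
  proof -
    have "9 * L' \<le> 10000 * (L' * L')" using L'_ge mult_left_mono[of 1 L' L'] by linarith
    then show ?thesis using L'_ge by (simp add: power_divide power_mult_distrib power2_eq_square divide_simps)
  qed
  also have "\<dots> \<le> 1 / ln d" using L'_ge assms(2) by (intro divide_left_mono) auto
  finally have B: "measure ?M ?B \<le> 1 / ln d" .
  have "measure ?M {Z \<in> space ?M. robust_bad m P d (W T) \<epsilon> (test_pt d \<alpha> y' s' Z) y'} \<le> 1 / ln d"
    if "y' \<in> {1, -1}" "s' \<in> {..<P}" for y' s'
  proof -
    have "{Z \<in> space ?M. robust_bad m P d (W T) \<epsilon> (test_pt d \<alpha> y' s' Z) y'} \<subseteq> ?B"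
    proof (intro subsetI, rule ccontr)
      fix Z assume Z: "Z \<in> {Z \<in> space ?M. robust_bad m P d (W T) \<epsilon> (test_pt d \<alpha> y' s' Z) y'}" "Z \<notin> ?B"
      then obtain \<Delta> where \<Delta>: "\<And>p j. p < P \<Longrightarrow> j < d \<Longrightarrow> \<bar>\<Delta> p j\<bar> \<le> \<epsilon>"
        "y' * fW m P d (W T) (\<lambda>p j. test_pt d \<alpha> y' s' Z p j + \<Delta> p j) < 0"
        by (auto simp: robust_bad_def)
      have "G / 64 - (2 + 36 * C) \<le> y' * fW m P d (W T) (\<lambda>p j. test_pt d \<alpha> y' s' Z p j + \<Delta> p j)"
        using that Z \<Delta>(1) by (intro robust_margin_ge) (auto simp: c_def)
      moreover have "0 \<le> G / 64 - (2 + 36 * C)" using assms(1) by linarith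
      ultimately show False using \<Delta>(2) by (meson not_le order_trans)
    qed
    \<comment> \<open>Monotonicity rests on measurability of the larger set, the tail event.\<close>
    then have "measure ?M {Z \<in> space ?M. robust_bad m P d (W T) \<epsilon> (test_pt d \<alpha> y' s' Z) y'} \<le> measure ?M ?B"
      using tail(2) by (intro finite_measure_mono)
    with B show ?thesis by linarith
  qed
  then have "(\<Sum>y'\<in>{1::real, -1}. \<Sum>s'<P.
        measure ?M {Z \<in> space ?M. robust_bad m P d (W T) \<epsilon> (test_pt d \<alpha> y' s' Z) y'})
      \<le> (\<Sum>y'\<in>{1::real, -1}. \<Sum>s'<P. 1 / ln d)"
    by (intro sum_mono) auto
  also have "\<dots> = (1 / ln d) * (2 * P)" by simp
  finally show ?thesis unfolding rob_test_err_def using pos by (subst pos_divide_le_eq) auto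
qed

lemma signal_conclusion: "\<exists>r<m. W T r 0 \<ge> 1 / (C * \<alpha> * L' ^ nat \<lceil>C\<rceil>)"
proof -
  from signal_learned obtain r where r: "r < m" "1 / m \<le> \<alpha> * W T r 0" by blast
  have "1 / (C * L' ^ nat \<lceil>C\<rceil>) \<le> 1 / m"
    using m_le_polylog m_ge C_ge L'_ge by (intro divide_left_mono) auto
  with r(2) have "1 / (C * L' ^ nat \<lceil>C\<rceil>) \<le> \<alpha> * W T r 0" by linarith
  then have "1 / (C * L' ^ nat \<lceil>C\<rceil>) / \<alpha> \<le> W T r 0"
    using pos by (subst pos_divide_le_eq) (auto simp: mult.commute)
  then have "1 / (C * \<alpha> * L' ^ nat \<lceil>C\<rceil>) \<le> W T r 0" by (simp add: mult_ac)
  with r show ?thesis by blast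
qed

lemma noise_conclusion:
  assumes "r < m" "i < N" "p < P" "p \<noteq> s i"
  shows "\<bar>ip d (W T r) (X i p)\<bar> \<le> C * \<sigma>0 * \<sigma>n * sqrt d * L' ^ nat \<lceil>C\<rceil>"
proof -
  have "\<bar>ip d (W T r) (X i p)\<bar> \<le> 2 * A"
    using noise_small[of T] assms by (simp add: noise_small_def z_def)
  also have "\<dots> = 8 * \<sigma>0 * q * L" by (simp add: A_def)
  also have "\<dots> \<le> C * \<sigma>0 * q * L' ^ nat \<lceil>C\<rceil>"
  proof (intro mult_mono)
    have "nat \<lceil>C\<rceil> \<ge> 1" using C_ge by linarith
    then have "L' ^ 1 \<le> L' ^ nat \<lceil>C\<rceil>" using L'_ge by (intro power_increasing) auto
    then show "L \<le> L' ^ nat \<lceil>C\<rceil>" using L'_ge by simp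
  qed (use C_ge pos q_pos L_ge_1 in auto)
  finally show ?thesis by (simp add: q_def mult.assoc)
qed

end

section \<open>Passage to the limit in the dimension\<close>

lemma eventually_lnlnln_ge: "eventually (\<lambda>d::nat. M \<le> ln (ln (ln (real d)))) at_top"
proof -
  have "filterlim (\<lambda>d::nat. ln (ln (ln (real d)))) at_top at_top"
    by (intro filterlim_compose[OF ln_at_top] filterlim_real_sequentially)
  then show ?thesis by (simp add: filterlim_at_top)
qed

theorem theoremG2:
  shows "\<exists>C0>0. \<forall>C\<ge>C0. \<exists>c>0. \<exists>k::nat.
    (\<forall>N P d m \<alpha> \<sigma>n \<sigma>0 \<eta> \<epsilon> \<Gamma> \<delta> T y s X W adv.
       AT_setting C N P d m \<alpha> \<sigma>n \<sigma>0 \<eta> \<epsilon> \<Gamma> \<delta> T y s X W adv \<longrightarrow>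
         (\<exists>r<m. W T r 0 \<ge> 1 / (c * \<alpha> * (ln (T * d * N * m * P / \<delta>)) ^ k)) \<and>
         (\<forall>r<m. \<forall>i<N. \<forall>j<P. j \<noteq> s i \<longrightarrow>
            \<bar>ip d (W T r) (X i j)\<bar> \<le> c * \<sigma>0 * \<sigma>n * sqrt d * (ln (T * d * N * m * P / \<delta>)) ^ k)) \<and>
    (\<forall>e>0. \<exists>D::nat. \<forall>N P d m \<alpha> \<sigma>n \<sigma>0 \<eta> \<epsilon> \<Gamma> \<delta> T y s X W adv.
       AT_setting C N P d m \<alpha> \<sigma>n \<sigma>0 \<eta> \<epsilon> \<Gamma> \<delta> T y s X W adv \<and> d \<ge> D \<longrightarrow>
         rob_train_err N P d m T y s X W adv \<le> e \<and>
         rob_test_err m P d \<alpha> \<sigma>n \<epsilon> (W T) \<le> e)"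
proof (rule exI[of _ "100::real"], rule conjI, simp, intro allI impI)
  fix C :: real assume C: "100 \<le> C"
  \<comment> \<open>The constant hidden in the order notation is C itself, and the exponent of the
    logarithm is the one of \<open>m_le_polylog\<close>.\<close>
  have filters: "(\<exists>r<m. W T r 0 \<ge> 1 / (C * \<alpha> * (ln (real T * real d * real N * real m * real P / \<delta>)) ^ nat \<lceil>C\<rceil>)) \<and>
         (\<forall>r<m. \<forall>i<N. \<forall>j<P. j \<noteq> s i \<longrightarrow>
            \<bar>ip d (W T r) (X i j)\<bar> \<le> C * \<sigma>0 * \<sigma>n * sqrt d * (ln (real T * real d * real N * real m * real P / \<delta>)) ^ nat \<lceil>C\<rceil>)"
    if "AT_setting C N P d m \<alpha> \<sigma>n \<sigma>0 \<eta> \<epsilon> \<Gamma> \<delta> T y s X W adv"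
    for N P d m \<alpha> \<sigma>n \<sigma>0 \<eta> \<epsilon> \<Gamma> \<delta> T y s X W adv
  proof -
    interpret adversarial_training C N P d m \<alpha> \<sigma>n \<sigma>0 \<eta> \<epsilon> \<Gamma> \<delta> T y s X W adv
      using that C by unfold_locales
    show ?thesis using signal_conclusion noise_conclusion unfolding L'_def by blast
  qed
  have errors: "\<exists>D::nat. \<forall>N P d m \<alpha> \<sigma>n \<sigma>0 \<eta> \<epsilon> \<Gamma> \<delta> T y s X W adv.
       AT_setting C N P d m \<alpha> \<sigma>n \<sigma>0 \<eta> \<epsilon> \<Gamma> \<delta> T y s X W adv \<and> d \<ge> D \<longrightarrow>
         rob_train_err N P d m T y s X W adv \<le> e \<and>
         rob_test_err m P d \<alpha> \<sigma>n \<epsilon> (W T) \<le> e" if e: "e > 0" for e :: real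
  proof -
    \<comment> \<open>The first two summands make \<open>test_err_le\<close> applicable, the maximum
      gives 1 - M/8 \<le> ln e for the training error, and 1/e gives 1 / ln d \<le> e for the test
      error.\<close>
    define M where "M = 128 + 2304 * C + max 0 (8 - 8 * ln e) + 1 / e"
    have M: "M \<ge> 128 + 2304 * C" "M \<ge> 8 - 8 * ln e" "M \<ge> 1 / e" "M > 0"
      using C e max.cobounded1[of 0 "8 - 8 * ln e"] max.cobounded2[of "8 - 8 * ln e" 0]
        divide_pos_pos[OF zero_less_one e] unfolding M_def by linarith+
    obtain D :: nat where D: "\<And>d. d \<ge> D \<Longrightarrow> M \<le> ln (ln (ln (real d)))"
      using eventually_lnlnln_ge[of M] by (auto simp: eventually_at_top_linorder)
    show ?thesis
    proof (intro exI[of _ "max D 3"] allI impI)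
      fix N P d m \<alpha> \<sigma>n \<sigma>0 \<eta> \<epsilon> \<Gamma> \<delta> T y s X W adv
      assume *: "AT_setting C N P d m \<alpha> \<sigma>n \<sigma>0 \<eta> \<epsilon> \<Gamma> \<delta> T y s X W adv \<and> max D 3 \<le> d"
      then interpret adversarial_training C N P d m \<alpha> \<sigma>n \<sigma>0 \<eta> \<epsilon> \<Gamma> \<delta> T y s X W adv
        using C by unfold_locales auto
      have d: "real d \<ge> 3" "M \<le> ln (ln (ln (real d)))" using * D by auto
      have "exp 1 \<le> real d" using d exp_le by linarith
      then have ld: "ln d \<ge> 1" using d by (subst ln_ge_iff) auto
      then have lld0: "ln (ln d) \<ge> 0" by simp
      \<comment> \<open>If ln (ln d) were 0, the outer logarithm would take the value ln 0 = 0,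
        against M > 0.\<close>
      have lld: "ln (ln d) > 0"
        using d(2) M(4) lld0 by (cases "ln (ln (real d)) = 0") auto
      have "ln (ln (ln d)) \<le> ln L" using lld L_ge_lnln by simp
      with d have G: "M \<le> G" using G_ge_lnL by linarith
      have "M \<le> ln d"
        using d(2) ln_le_minus_one[of "ln (ln d)"] ln_le_minus_one[of "ln d"] lld ld by linarith
      with M have "1 / e \<le> ln d" by linarith
      then have "1 / ln d \<le> e" using e ld by (simp add: field_simps)
      moreover have "rob_test_err m P d \<alpha> \<sigma>n \<epsilon> (W T) \<le> 1 / ln d"
        using G M ld by (intro test_err_le) auto
      moreover have "exp (1 - G / 8) \<le> exp (ln e)" using G M by simp
      ultimately show "rob_train_err N P d m T y s X W adv \<le> e \<and> rob_test_err m P d \<alpha> \<sigma>n \<epsilon> (W T) \<le> e"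
        using train_err_le e by simp
    qed
  qed
  show "\<exists>c>0. \<exists>k::nat.
    (\<forall>N P d m \<alpha> \<sigma>n \<sigma>0 \<eta> \<epsilon> \<Gamma> \<delta> T y s X W adv.
       AT_setting C N P d m \<alpha> \<sigma>n \<sigma>0 \<eta> \<epsilon> \<Gamma> \<delta> T y s X W adv \<longrightarrow>
         (\<exists>r<m. W T r 0 \<ge> 1 / (c * \<alpha> * (ln (T * d * N * m * P / \<delta>)) ^ k)) \<and>
         (\<forall>r<m. \<forall>i<N. \<forall>j<P. j \<noteq> s i \<longrightarrow>
            \<bar>ip d (W T r) (X i j)\<bar> \<le> c * \<sigma>0 * \<sigma>n * sqrt d * (ln (T * d * N * m * P / \<delta>)) ^ k)) \<and>
    (\<forall>e>0. \<exists>D::nat. \<forall>N P d m \<alpha> \<sigma>n \<sigma>0 \<eta> \<epsilon> \<Gamma> \<delta> T y s X W adv.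
       AT_setting C N P d m \<alpha> \<sigma>n \<sigma>0 \<eta> \<epsilon> \<Gamma> \<delta> T y s X W adv \<and> d \<ge> D \<longrightarrow>
         rob_train_err N P d m T y s X W adv \<le> e \<and>
         rob_test_err m P d \<alpha> \<sigma>n \<epsilon> (W T) \<le> e)"
  proof (rule exI[of _ C], rule conjI)
    show "0 < C" using C by simp
  qed (rule exI[of _ "nat \<lceil>C\<rceil>"], rule conjI, simp only: of_nat_mult, intro allI impI, erule filters,
      intro allI impI, erule errors[rule_format])
qed

end
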